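(* Let $(X,\mathcal{L})$ be an $\omega$-topological space, and let $\mu$ and $\nu$ be two $\sigma$-finite $\omega$-continuous valuations on $(X,\mathcal{L})$. Let $(E_n)_{n\in\mathbb{N}}$ be any witness of joint $\sigma$-finiteness of $\nu$ and $\mu$, i.e. any monotone sequence $E_0\subseteq E_1\subseteq\cdots$ of elements of $\mathcal{L}$ such that $\bigcup_{n\in\mathbb{N}}E_n=X$ and $\nu(E_n)<\infty$, $\mu(E_n)<\infty$ for each $n\in\mathbb{N}$. Then the following properties are equivalent: (1) there is a function $g\in\mathfrak{L}(X,\mathcal{L})$ such that $\nu=g\cdot\mu$; (2) the following two conditions are met: (2a) $\nu$ is absolutely continuous with respect to $\mu$; (2b) for every $n\in\mathbb{N}$ and every $r\in\mathbb{R}_+$, the signed valuation $\nu_{|E_n}-r\cdot\mu_{|E_n}$ has the Hahn decomposition property.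
   Context: $\mathbb{R}_+=[0,\infty[$ and $\overline{\mathbb{R}}_+=\mathbb{R}_+\cup\{\infty\}$, with $0\cdot\infty=\infty\cdot 0=0$. A lattice of subsets of $X$ is a family of subsets closed under finite unions and finite intersections (so it contains $\emptyset$ and $X$). An $\omega$-topological space is a pair $(X,\mathcal{L})$ where $\mathcal{L}$ is a lattice of subsets of $X$ closed under countable unions. A valuation on $(X,\mathcal{L})$ is a map $\nu\colon\mathcal{L}\to\overline{\mathbb{R}}_+$ that is strict ($\nu(\emptyset)=0$), monotonic ($U\subseteq V$ implies $\nu(U)\le\nu(V)$) and modular ($\nu(U)+\nu(V)=\nu(U\cup V)+\nu(U\cap V)$). It is $\omega$-continuous if $\nu(\bigcup_n U_n)=\sup_n\nu(U_n)$ for every monotone sequence $U_0\subseteq U_1\subseteq\cdots$ in $\mathcal{L}$. It is $\sigma$-finite if there are countably many sets $F_n\in\mathcal{L}$ with $\bigcup_n F_n=X$ and $\nu(F_n)<\infty$ for each $n$. $\mathfrak{L}(X,\mathcal{L})$ is the set of functions $h\colon X\to\overline{\mathbb{R}}_+$ such that $h^{-1}(]t,\infty])\in\mathcal{L}$ for every $t\in\mathbb{R}_+$. For such $h$, the Choquet integral is $\int h\,d\mu=\int_0^\infty\mu(h^{-1}(]t,\infty]))\,dt$ (improper Riemann integral of an antitonic function). For $g\in\mathfrak{L}(X,\mathcal{L})$, $g\cdot\mu$ is defined by $(g\cdot\mu)(U)=\int\chi_U\,g\,d\mu$ for $U\in\mathcal{L}$, where $\chi_U$ is the characteristic function of $U$.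 $\nu$ is absolutely continuous with respect to $\mu$ if for every $U_0\in\mathcal{L}$ with $\nu(U_0)<\infty$ and every real $\epsilon>0$ there is a real $\eta>0$ such that every $U\in\mathcal{L}$ with $U\subseteq U_0$ and $\mu(U)<\eta$ satisfies $\nu(U)<\epsilon$. For $U_0\in\mathcal{L}$, $\nu_{|U_0}(U)=\nu(U\cap U_0)$. A signed valuation is a map $\varsigma\colon\mathcal{L}\to\mathbb{R}$ that is strict and modular. A crescent is a set $U\setminus V$ with $U,V\in\mathcal{L}$. Every signed valuation extends uniquely to a signed valuation, still written $\varsigma$, on the smallest algebra of subsets $\mathcal{A}(\mathcal{L})$ containing $\mathcal{L}$, and $\varsigma(U\setminus V)=\varsigma(U)-\varsigma(U\cap V)$ for $U,V\in\mathcal{L}$. A signed valuation $\varsigma$ has the Hahn decomposition property if there is a $U\in\mathcal{L}$ such that $\varsigma(C)\ge 0$ for every crescent $C\subseteq U$ and $\varsigma(C)\le 0$ for every crescent $C$ disjoint from $U$. *)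

theory Defs
  imports "HOL-Analysis.Analysis"
begin

definition lattice_of_sets :: "'a set \<Rightarrow> 'a set set \<Rightarrow> bool" where
  "lattice_of_sets X L \<longleftrightarrow> L \<subseteq> Pow X \<and> {} \<in> L \<and> X \<in> L \<and>
     (\<forall>U\<in>L. \<forall>V\<in>L. U \<union> V \<in> L \<and> U \<inter> V \<in> L)"

definition omega_topological_space :: "'a set \<Rightarrow> 'a set set \<Rightarrow> bool" where
  "omega_topological_space X L \<longleftrightarrow> lattice_of_sets X L \<and>
     (\<forall>U :: nat \<Rightarrow> 'a set. (\<forall>n. U n \<in> L) \<longrightarrow> (\<Union>n. U n) \<in> L)"

text \<open>
  A map defined on \<open>L\<close> is represented by a total function on sets; its values outside \<open>L\<close> never
  matter.
\<close>

definition valuation :: "'a set set \<Rightarrow> ('a set \<Rightarrow> ennreal) \<Rightarrow> bool" where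
  "valuation L \<nu> \<longleftrightarrow> \<nu> {} = 0 \<and>
     (\<forall>U\<in>L. \<forall>V\<in>L. U \<subseteq> V \<longrightarrow> \<nu> U \<le> \<nu> V) \<and>
     (\<forall>U\<in>L. \<forall>V\<in>L. \<nu> U + \<nu> V = \<nu> (U \<union> V) + \<nu> (U \<inter> V))"

definition omega_continuous :: "'a set set \<Rightarrow> ('a set \<Rightarrow> ennreal) \<Rightarrow> bool" where
  "omega_continuous L \<nu> \<longleftrightarrow>
     (\<forall>U :: nat \<Rightarrow> 'a set. (\<forall>n. U n \<in> L) \<longrightarrow> incseq U \<longrightarrow> \<nu> (\<Union>n. U n) = (SUP n. \<nu> (U n)))"

definition sigma_finite_valuation :: "'a set \<Rightarrow> 'a set set \<Rightarrow> ('a set \<Rightarrow> ennreal) \<Rightarrow> bool" where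
  "sigma_finite_valuation X L \<nu> \<longleftrightarrow>
     (\<exists>F :: nat \<Rightarrow> 'a set. (\<forall>n. F n \<in> L \<and> \<nu> (F n) < \<infinity>) \<and> (\<Union>n. F n) = X)"

definition joint_sigma_finiteness_witness ::
    "'a set \<Rightarrow> 'a set set \<Rightarrow> ('a set \<Rightarrow> ennreal) \<Rightarrow> ('a set \<Rightarrow> ennreal) \<Rightarrow> (nat \<Rightarrow> 'a set) \<Rightarrow> bool" where
  "joint_sigma_finiteness_witness X L \<nu> \<mu> E \<longleftrightarrow>
     (\<forall>n. E n \<in> L) \<and> incseq E \<and> (\<Union>n. E n) = X \<and> (\<forall>n. \<nu> (E n) < \<infinity> \<and> \<mu> (E n) < \<infinity>)"

text \<open>The set \<open>\<LL>(X, L)\<close>; the values of a function outside \<open>X\<close> are irrelevant.\<close>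

definition measurable_maps :: "'a set \<Rightarrow> 'a set set \<Rightarrow> ('a \<Rightarrow> ennreal) set" where
  "measurable_maps X L = {h. \<forall>t::real\<ge>0. {x\<in>X. ennreal t < h x} \<in> L}"

text \<open>
  The improper Riemann integral over \<open>[0, \<infinity>[\<close> of an antitonic function with values in
  \<open>[0, \<infinity>]\<close>: the supremum (equivalently, the limit for \<open>a \<rightarrow> 0\<close>, \<open>b \<rightarrow> \<infinity>\<close>) of its integrals over the
  intervals \<open>[a, b]\<close> with \<open>0 < a\<close>. Such a function that is infinite at some \<open>t > 0\<close> is infinite on
  \<open>]0, t]\<close>, and has integral \<open>\<infinity>\<close>.
\<close>

definition improper_integral :: "(real \<Rightarrow> ennreal) \<Rightarrow> ennreal" where
  "improper_integral f =
     (if \<exists>t>0. f t = \<infinity> then \<infinity>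
      else SUP (a, b) \<in> {(a, b). 0 < a \<and> a \<le> b}. ennreal (integral {a..b} (\<lambda>t. enn2real (f t))))"

definition choquet_integral :: "'a set \<Rightarrow> ('a set \<Rightarrow> ennreal) \<Rightarrow> ('a \<Rightarrow> ennreal) \<Rightarrow> ennreal" where
  "choquet_integral X \<mu> h = improper_integral (\<lambda>t. \<mu> {x\<in>X. ennreal t < h x})"

definition density_valuation ::
    "'a set \<Rightarrow> ('a \<Rightarrow> ennreal) \<Rightarrow> ('a set \<Rightarrow> ennreal) \<Rightarrow> 'a set \<Rightarrow> ennreal" where
  "density_valuation X g \<mu> U = choquet_integral X \<mu> (\<lambda>x. indicator U x * g x)"

definition abs_continuous :: "'a set set \<Rightarrow> ('a set \<Rightarrow> ennreal) \<Rightarrow> ('a set \<Rightarrow> ennreal) \<Rightarrow> bool" where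
  "abs_continuous L \<nu> \<mu> \<longleftrightarrow>
     (\<forall>U0\<in>L. \<nu> U0 < \<infinity> \<longrightarrow> (\<forall>\<epsilon>::real>0. \<exists>\<eta>::real>0. \<forall>U\<in>L.
        U \<subseteq> U0 \<longrightarrow> \<mu> U < ennreal \<eta> \<longrightarrow> \<nu> U < ennreal \<epsilon>))"

definition restr :: "('a set \<Rightarrow> ennreal) \<Rightarrow> 'a set \<Rightarrow> 'a set \<Rightarrow> ennreal" where
  "restr \<nu> U0 U = \<nu> (U \<inter> U0)"

definition signed_valuation :: "'a set set \<Rightarrow> ('a set \<Rightarrow> real) \<Rightarrow> bool" where
  "signed_valuation L \<sigma> \<longleftrightarrow> \<sigma> {} = 0 \<and>
     (\<forall>U\<in>L. \<forall>V\<in>L. \<sigma> U + \<sigma> V = \<sigma> (U \<union> V) + \<sigma> (U \<inter> V))"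

text \<open>\<open>\<nu> - r \<cdot> \<mu>\<close> as a real-valued map; used only where \<open>\<nu>\<close> and \<open>\<mu>\<close> are finite on \<open>L\<close>.\<close>

definition signed_diff :: "('a set \<Rightarrow> ennreal) \<Rightarrow> real \<Rightarrow> ('a set \<Rightarrow> ennreal) \<Rightarrow> 'a set \<Rightarrow> real" where
  "signed_diff \<nu> r \<mu> U = enn2real (\<nu> U) - r * enn2real (\<mu> U)"

definition crescents :: "'a set set \<Rightarrow> 'a set set" where
  "crescents L = {U - V | U V. U \<in> L \<and> V \<in> L}"

definition generated_algebra :: "'a set \<Rightarrow> 'a set set \<Rightarrow> 'a set set" where
  "generated_algebra X L = \<Inter>{M. algebra X M \<and> L \<subseteq> M}"

text \<open>
  The extension of a signed valuation on \<open>L\<close> to the generated algebra. It exists by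
  \<open>signed_valuation_extends\<close> below and is unique on the algebra; in particular its values on crescents
  are those given by \<open>signed_ext_crescent\<close>.
\<close>

definition signed_ext :: "'a set \<Rightarrow> 'a set set \<Rightarrow> ('a set \<Rightarrow> real) \<Rightarrow> 'a set \<Rightarrow> real" where
  "signed_ext X L \<sigma> =
     (SOME \<sigma>'. signed_valuation (generated_algebra X L) \<sigma>' \<and> (\<forall>U\<in>L. \<sigma>' U = \<sigma> U))"

definition hahn_decomposition_property :: "'a set \<Rightarrow> 'a set set \<Rightarrow> ('a set \<Rightarrow> real) \<Rightarrow> bool" where
  "hahn_decomposition_property X L \<sigma> \<longleftrightarrow>
     (\<exists>U\<in>L. (\<forall>C\<in>crescents L. C \<subseteq> U \<longrightarrow> signed_ext X L \<sigma> C \<ge> 0) \<and>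
            (\<forall>C\<in>crescents L. C \<inter> U = {} \<longrightarrow> signed_ext X L \<sigma> C \<le> 0))"

lemma signed_valuation_extends_aux:
  assumes L: "lattice_of_sets X L" and \<sigma>: "signed_valuation L \<sigma>"
  shows "\<exists>M \<phi>. algebra X M \<and> L \<subseteq> M \<and> signed_valuation M \<phi> \<and> (\<forall>U\<in>L. \<phi> U = \<sigma> U)"
proof -
  define good where "good G \<longleftrightarrow> fst ` G \<subseteq> Pow X \<and> (\<forall>A a b. (A, a) \<in> G \<longrightarrow> (A, b) \<in> G \<longrightarrow> a = b) \<and>
      (\<forall>U\<in>L. (U, \<sigma> U) \<in> G) \<and>
      (\<forall>A a B b. (A, a) \<in> G \<longrightarrow> (B, b) \<in> G \<longrightarrow>
         (\<exists>c d. (A \<union> B, c) \<in> G \<and> (A \<inter> B, d) \<in> G \<and> a + b = c + d))"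
    for G :: "('a set \<times> real) set"
  have good0: "good {(U, \<sigma> U) | U. U \<in> L}"
    unfolding good_def
  proof (intro conjI allI impI ballI)
    show "fst ` {(U, \<sigma> U) | U. U \<in> L} \<subseteq> Pow X"
      using L unfolding lattice_of_sets_def by fastforce
  next
    fix A a B b assume "(A, a) \<in> {(U, \<sigma> U) | U. U \<in> L}" "(B, b) \<in> {(U, \<sigma> U) | U. U \<in> L}"
    then have "A \<in> L" "B \<in> L" "a = \<sigma> A" "b = \<sigma> B" by auto
    moreover from this have "A \<union> B \<in> L" "A \<inter> B \<in> L" using L by (auto simp: lattice_of_sets_def)
    ultimately show "\<exists>c d. (A \<union> B, c) \<in> {(U, \<sigma> U) | U. U \<in> L} \<and>
        (A \<inter> B, d) \<in> {(U, \<sigma> U) | U. U \<in> L} \<and> a + b = c + d"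
      using \<sigma> unfolding signed_valuation_def by blast
  qed auto
  have good_X: "A \<subseteq> X" if "good G" "(A, a) \<in> G" for G A a
    using that unfolding good_def by force
  have good_fun: "a = b" if "good G" "(A, a) \<in> G" "(A, b) \<in> G" for G A a b
    using that unfolding good_def by meson
  have good_L: "(U, \<sigma> U) \<in> G" if "good G" "U \<in> L" for G U
    using that unfolding good_def by meson
  have good_mod: "\<exists>c d. (A \<union> B, c) \<in> G \<and> (A \<inter> B, d) \<in> G \<and> a + b = c + d"
    if "good G" "(A, a) \<in> G" "(B, b) \<in> G" for G A a B b
    using that unfolding good_def by meson
  have "\<exists>G\<in>{G. good G}. \<forall>H\<in>{G. good G}. G \<subseteq> H \<longrightarrow> H = G"
  proof (rule subset_Zorn_nonempty)
    show "{G. good G} \<noteq> {}" using good0 by blast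
    fix \<C> assume ne: "\<C> \<noteq> {}" and ch: "subset.chain {G. good G} \<C>"
    have g: "\<And>G. G \<in> \<C> \<Longrightarrow> good G" and tot: "\<And>G H. G \<in> \<C> \<Longrightarrow> H \<in> \<C> \<Longrightarrow> G \<subseteq> H \<or> H \<subseteq> G"
      using ch by (auto simp: subset.chain_def)
    have common: "\<exists>G\<in>\<C>. p \<in> G \<and> q \<in> G" if "p \<in> \<Union>\<C>" "q \<in> \<Union>\<C>" for p q
      using that tot by (meson UnionE subsetD)
    have "good (\<Union>\<C>)"
      unfolding good_def
    proof (intro conjI allI impI ballI)
      show "fst ` \<Union>\<C> \<subseteq> Pow X" using g good_X by fastforce
      show "a = b" if ab: "(A, a) \<in> \<Union>\<C>" "(A, b) \<in> \<Union>\<C>" for A a b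
        using common[OF ab] g good_fun by blast
      show "(U, \<sigma> U) \<in> \<Union>\<C>" if "U \<in> L" for U
        using that ne g good_L by blast
      show "\<exists>c d. (A \<union> B, c) \<in> \<Union>\<C> \<and> (A \<inter> B, d) \<in> \<Union>\<C> \<and> a + b = c + d"
        if ab: "(A, a) \<in> \<Union>\<C>" "(B, b) \<in> \<Union>\<C>" for A a B b
      proof -
        obtain G where G: "G \<in> \<C>" "(A, a) \<in> G" "(B, b) \<in> G" using common[OF ab] by blast
        then have "\<exists>c d. (A \<union> B, c) \<in> G \<and> (A \<inter> B, d) \<in> G \<and> a + b = c + d"
          using good_mod[OF g[OF G(1)]] by blast
        then show ?thesis using G(1) by blast
      qed
    qed
    then show "\<Union>\<C> \<in> {G. good G}" by simp
  qed
  then obtain G where G: "good G" and max: "\<And>H. good H \<Longrightarrow> G \<subseteq> H \<Longrightarrow> H = G" by blast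
  define M where "M = fst ` G"
  define \<phi> where "\<phi> A = (THE a. (A, a) \<in> G)" for A
  have \<phi>: "a = \<phi> A" if "(A, a) \<in> G" for A a
    unfolding \<phi>_def using that good_fun[OF G] by (intro the_equality[symmetric]) auto
  have \<phi>M: "(A, \<phi> A) \<in> G" if "A \<in> M" for A
    using that \<phi> unfolding M_def by fastforce
  have MX: "M \<subseteq> Pow X" using good_X[OF G] unfolding M_def by force
  have L\<phi>: "U \<in> M \<and> \<phi> U = \<sigma> U" if "U \<in> L" for U
  proof -
    have "(U, \<sigma> U) \<in> G" using good_L[OF G that] .
    then show ?thesis using \<phi>[of U "\<sigma> U"] unfolding M_def by force
  qed
  have MM: "A \<union> B \<in> M \<and> A \<inter> B \<in> M \<and> \<phi> A + \<phi> B = \<phi> (A \<union> B) + \<phi> (A \<inter> B)"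
    if AB: "A \<in> M" "B \<in> M" for A B
  proof -
    obtain c d where "(A \<union> B, c) \<in> G" "(A \<inter> B, d) \<in> G" "\<phi> A + \<phi> B = c + d"
      using good_mod[OF G \<phi>M[OF AB(1)] \<phi>M[OF AB(2)]] by blast
    moreover from this have "A \<union> B \<in> M" "A \<inter> B \<in> M" unfolding M_def by force+
    ultimately show ?thesis using \<phi> by metis
  qed
  have emp: "{} \<in> M" "X \<in> M" "\<phi> {} = 0"
    using L \<sigma> L\<phi>[of "{}"] L\<phi>[of X] by (auto simp: lattice_of_sets_def signed_valuation_def)
  have compl: "X - V \<in> M" if V: "V \<in> M" for V
  proof -
    define P where "P = {A. A \<subseteq> X \<and> A \<inter> V \<in> M \<and> A \<union> V \<in> M}"
    define \<psi> where "\<psi> A = \<phi> (A \<inter> V) + \<phi> (A \<union> V) - \<phi> V" for A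
    define H where "H = {(A, \<psi> A) | A. A \<in> P}"
    have MP: "A \<in> P \<and> \<psi> A = \<phi> A" if "A \<in> M" for A
      using MM[OF that V] MX that by (auto simp: P_def \<psi>_def)
    have PP: "A \<union> B \<in> P \<and> A \<inter> B \<in> P \<and> \<psi> A + \<psi> B = \<psi> (A \<union> B) + \<psi> (A \<inter> B)"
      if A: "A \<in> P" and B: "B \<in> P" for A B
    proof -
      have *: "(A \<union> B) \<inter> V = (A \<inter> V) \<union> (B \<inter> V)" "(A \<inter> B) \<inter> V = (A \<inter> V) \<inter> (B \<inter> V)"
        "(A \<union> B) \<union> V = (A \<union> V) \<union> (B \<union> V)" "(A \<inter> B) \<union> V = (A \<union> V) \<inter> (B \<union> V)"
        by auto
      have "A \<inter> V \<in> M" "B \<inter> V \<in> M" "A \<union> V \<in> M" "B \<union> V \<in> M" "A \<subseteq> X" "B \<subseteq> X"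
        using A B by (auto simp: P_def)
      with MM[of "A \<inter> V" "B \<inter> V"] MM[of "A \<union> V" "B \<union> V"] show ?thesis
        unfolding P_def \<psi>_def mem_Collect_eq * by auto
    qed
    have "good H"
      unfolding good_def
    proof (intro conjI allI impI ballI)
      show "fst ` H \<subseteq> Pow X" by (auto simp: H_def P_def)
      show "a = b" if "(A, a) \<in> H" "(A, b) \<in> H" for A a b using that by (auto simp: H_def)
      show "(U, \<sigma> U) \<in> H" if "U \<in> L" for U
        using L\<phi>[OF that] MP[of U] by (auto simp: H_def)
      show "\<exists>c d. (A \<union> B, c) \<in> H \<and> (A \<inter> B, d) \<in> H \<and> a + b = c + d"
        if "(A, a) \<in> H" "(B, b) \<in> H" for A a B b
        using that PP[of A B] by (auto simp: H_def)
    qed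
    moreover have "G \<subseteq> H"
    proof
      fix p assume p: "p \<in> G"
      then have "fst p \<in> M" "snd p = \<phi> (fst p)" using \<phi>[of "fst p" "snd p"] by (auto simp: M_def)
      then show "p \<in> H" using MP[of "fst p"] by (cases p) (auto simp: H_def)
    qed
    ultimately have HG: "H = G" by (rule max)
    have "X - V \<in> P"
    proof -
      have "(X - V) \<inter> V = {}" "(X - V) \<union> V = X" using MX V by auto
      then show ?thesis using emp by (simp add: P_def)
    qed
    then have "(X - V, \<psi> (X - V)) \<in> G" unfolding HG[symmetric] H_def by blast
    then show ?thesis unfolding M_def by force
  qed
  have "algebra X M"
    unfolding algebra_iff_Un using MX emp compl MM by blast
  moreover have "signed_valuation M \<phi>"
    unfolding signed_valuation_def using MM emp by blast
  ultimately show ?thesis using L\<phi> by blast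
qed

lemma signed_valuation_extends:
  assumes "lattice_of_sets X L" and "signed_valuation L \<sigma>"
  shows "\<exists>\<sigma>'. signed_valuation (generated_algebra X L) \<sigma>' \<and> (\<forall>U\<in>L. \<sigma>' U = \<sigma> U)"
proof -
  obtain M \<phi> where "algebra X M" "L \<subseteq> M" "signed_valuation M \<phi>" "\<forall>U\<in>L. \<phi> U = \<sigma> U"
    using signed_valuation_extends_aux[OF assms] by blast
  moreover from this have "generated_algebra X L \<subseteq> M"
    by (auto simp: generated_algebra_def)
  ultimately show ?thesis unfolding signed_valuation_def by blast
qed

lemma signed_ext_crescent:
  assumes L: "lattice_of_sets X L" and \<sigma>: "signed_valuation L \<sigma>" and U: "U \<in> L" and V: "V \<in> L"
  shows "signed_ext X L \<sigma> (U - V) = \<sigma> U - \<sigma> (U \<inter> V)"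
proof -
  let ?s = "signed_ext X L \<sigma>"
  have s: "signed_valuation (generated_algebra X L) ?s" "\<forall>U\<in>L. ?s U = \<sigma> U"
    using someI_ex[OF signed_valuation_extends[OF L \<sigma>]] unfolding signed_ext_def by blast+
  have UV: "U \<inter> V \<in> L" using L U V by (auto simp: lattice_of_sets_def)
  have "U - V \<in> M" if "algebra X M" "L \<subseteq> M" for M
    using that U V by (meson algebra.axioms(1) ring_of_sets.Diff subsetD)
  then have in_alg: "U - V \<in> generated_algebra X L" "U \<inter> V \<in> generated_algebra X L"
    using UV by (auto simp: generated_algebra_def)
  have "(U - V) \<union> (U \<inter> V) = U" "(U - V) \<inter> (U \<inter> V) = {}" by auto
  moreover have "?s (U - V) + ?s (U \<inter> V) = ?s ((U - V) \<union> (U \<inter> V)) + ?s ((U - V) \<inter> (U \<inter> V))"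
    using s(1) in_alg unfolding signed_valuation_def by blast
  moreover have "?s {} = 0" using s(1) by (simp add: signed_valuation_def)
  ultimately show ?thesis using s(2) U UV by auto
qed

lemma improper_integral_eq_nn_integral:
  assumes anti: "\<And>s t. 0 < s \<Longrightarrow> s \<le> t \<Longrightarrow> f t \<le> f s"
  shows "improper_integral f = (\<integral>\<^sup>+t\<in>{0<..}. f t \<partial>lborel)"
proof (cases "\<exists>t>0. f t = \<infinity>")
  case True
  then obtain t where t: "t > 0" "f t = \<infinity>" by blast
  have "f s = \<infinity>" if "0 < s" "s \<le> t" for s
    using anti[OF that] t by (simp add: top_unique)
  then have "(\<integral>\<^sup>+s. \<infinity> * indicator {0<..t} s \<partial>lborel) \<le> (\<integral>\<^sup>+s\<in>{0<..}. f s \<partial>lborel)"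
    by (intro nn_integral_mono) (auto simp: indicator_def top_unique)
  moreover have "(\<integral>\<^sup>+s. \<infinity> * indicator {0<..t} s \<partial>lborel) = \<infinity>"
    using t by (subst nn_integral_cmult_indicator) (auto simp: ennreal_top_mult)
  ultimately show ?thesis using True by (simp add: improper_integral_def top_unique)
next
  case False
  then have fin: "ennreal (enn2real (f t)) = f t" if "t > 0" for t
    using that by (simp add: less_top)
  have int: "ennreal (integral {a..b} (\<lambda>t. enn2real (f t))) = (\<integral>\<^sup>+t\<in>{a..b}. f t \<partial>lborel)"
    if a: "0 < a" for a b
  proof -
    have "mono_on {a..b} (\<lambda>t. - enn2real (f t))"
    proof (rule mono_onI)
      fix r s assume "r \<in> {a..b}" "s \<in> {a..b}" "r \<le> s"
      then have "f s \<le> f r" "f r < top" using a anti False by (auto simp: less_top)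
      then show "- enn2real (f r) \<le> - enn2real (f s)" by (simp add: enn2real_mono)
    qed
    from integrable_neg[OF integrable_on_mono_on[OF this]]
    have "(\<lambda>t. enn2real (f t)) integrable_on {a..b}" by simp
    then have "(\<integral>\<^sup>+t\<in>{a..b}. ennreal (enn2real (f t)) \<partial>lborel) =
        ennreal (integral {a..b} (\<lambda>t. enn2real (f t)))"
      by (intro nn_integral_has_integral_lebesgue') (auto intro: integrable_integral)
    moreover have "(\<integral>\<^sup>+t\<in>{a..b}. ennreal (enn2real (f t)) \<partial>lborel) = (\<integral>\<^sup>+t\<in>{a..b}. f t \<partial>lborel)"
      using a fin by (intro nn_integral_cong) (auto simp: indicator_def)
    ultimately show ?thesis by simp
  qed
  define g where "g t = (if t > 0 then f t else \<infinity>)" for t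
  have g_anti: "g t \<le> g s" if "s \<le> t" for s t using anti that by (auto simp: g_def)
  have [measurable]: "g \<in> borel_measurable borel"
  proof (rule borel_measurableI_greater)
    fix y
    have "is_interval {t. y < g t}"
      unfolding is_interval_1 using g_anti by (auto intro: less_le_trans)
    then show "{t \<in> space borel. y < g t} \<in> sets borel"
      using real_interval_borel_measurable by simp
  qed
  define I where "I n = {inverse (real (Suc n))..real (Suc n)}" for n
  have I0: "0 < inverse (real (Suc n))" "inverse (real (Suc n)) \<le> real (Suc n)" for n
    by (auto simp: field_simps)
  have incI: "I m \<subseteq> I n" if "m \<le> n" for m n
    using that by (auto simp: I_def intro: order_trans[OF le_imp_inverse_le])
  have UI: "\<exists>n. t \<in> I n" if t: "t > 0" for t
  proof -
    obtain m where m: "t \<le> real m" using real_arch_simple by blast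
    obtain k where k: "inverse (real (Suc k)) < t" using reals_Archimedean[OF t] by blast
    have "t \<in> I (max m k)"
    proof -
      have "inverse (real (Suc (max m k))) \<le> inverse (real (Suc k))"
        by (rule le_imp_inverse_le) auto
      moreover have "real m \<le> real (Suc (max m k))" by simp
      ultimately show ?thesis using m k unfolding I_def atLeastAtMost_iff by linarith
    qed
    then show ?thesis by blast
  qed
  have SUPI: "f t * indicator {0<..} t = (SUP n. g t * indicator (I n) t)" for t
  proof (cases "t > 0")
    case True
    then obtain n where "t \<in> I n" using UI by blast
    then show ?thesis using True
      by (intro antisym SUP_upper2[of n] SUP_least) (auto simp: g_def indicator_def)
  next
    case False
    then have "t \<notin> I n" for n using I0(1)[of n] unfolding I_def atLeastAtMost_iff by linarith
    then show ?thesis using False by simp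
  qed
  have "(\<integral>\<^sup>+t\<in>{0<..}. f t \<partial>lborel) = (SUP n. \<integral>\<^sup>+t. g t * indicator (I n) t \<partial>lborel)"
    unfolding SUPI
  proof (rule nn_integral_monotone_convergence_SUP)
    show "incseq (\<lambda>n t. g t * indicator (I n) t)"
      using incI by (fastforce simp: incseq_def le_fun_def indicator_def)
    show "(\<lambda>t. g t * indicator (I n) t) \<in> borel_measurable lborel" for n
      by (simp add: I_def)
  qed
  also have "\<dots> = (SUP n. ennreal (integral (I n) (\<lambda>t. enn2real (f t))))"
  proof (rule SUP_cong)
    fix n
    have "(\<integral>\<^sup>+t. g t * indicator (I n) t \<partial>lborel) = (\<integral>\<^sup>+t\<in>I n. f t \<partial>lborel)"
      using order_less_le_trans[OF I0(1)[of n]]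
      by (intro nn_integral_cong) (simp add: g_def I_def indicator_def)
    then show "(\<integral>\<^sup>+t. g t * indicator (I n) t \<partial>lborel) = ennreal (integral (I n) (\<lambda>t. enn2real (f t)))"
      using int[OF I0(1)] by (simp add: I_def)
  qed simp
  also have "\<dots> \<le> improper_integral f"
  proof (rule SUP_least)
    fix n
    show "ennreal (integral (I n) (\<lambda>t. enn2real (f t))) \<le> improper_integral f"
      unfolding improper_integral_def if_not_P[OF False] I_def
      by (rule SUP_upper2[of "(inverse (real (Suc n)), real (Suc n))"]) (use I0 in auto)
  qed
  finally have "(\<integral>\<^sup>+t\<in>{0<..}. f t \<partial>lborel) \<le> improper_integral f" .
  moreover have "improper_integral f \<le> (\<integral>\<^sup>+t\<in>{0<..}. f t \<partial>lborel)"
    unfolding improper_integral_def if_not_P[OF False]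
  proof (rule SUP_least, clarify)
    fix a b :: real assume "0 < a" "a \<le> b"
    then show "ennreal (integral {a..b} (\<lambda>t. enn2real (f t))) \<le> (\<integral>\<^sup>+t\<in>{0<..}. f t \<partial>lborel)"
      unfolding int[OF \<open>0 < a\<close>] by (intro nn_integral_mono) (auto simp: indicator_def)
  qed
  ultimately show ?thesis by (rule antisym[rotated])
qed

end

theory Submission
  imports Defs
begin

text \<open>
  With \<open>G t = {g > t}\<close>, the density formula reads \<open>\<nu> U = \<integral>\<^sub>0\<^sup>\<infinity> \<mu> (U \<inter> G t) dt\<close>. It makes \<open>G r\<close> the
  positive part of a Hahn decomposition of \<open>\<nu> - r \<cdot> \<mu>\<close>, and its vanishing tail gives absolute continuity.

  Conversely, choose Hahn sets \<open>V n r \<subseteq> E n\<close> for all \<open>n\<close> and rational \<open>r \<ge> 0\<close>, and let \<open>g\<close> be the supremum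
  of the functions \<open>r \<cdot> \<chi> (V n r)\<close>. Its superlevel set \<open>G t\<close> is the countable union of the \<open>V n r\<close> with \<open>r > t\<close>;
  cutting a crescent inside \<open>G t\<close> successively along these sets, and using \<open>\<omega>\<close>-continuity, one sees
  that \<open>G t\<close> is a Hahn set for \<open>\<nu> - t \<cdot> \<mu>\<close> on every \<open>E n\<close>, with no need to compare the \<open>V n r\<close> with each other.
  Hence, for \<open>U \<subseteq> E n\<close>, the functions \<open>m t = \<mu> (U \<inter> G t)\<close> and \<open>w t = \<nu> (U \<inter> G t)\<close> satisfy
  \<open>s (m s - m t) \<le> w s - w t \<le> t (m s - m t)\<close> for \<open>s \<le> t\<close>, so \<open>w t - t m t + \<integral>\<^sub>0\<^sup>t m\<close> is constant, equal to
  \<open>w 0 = \<nu> U\<close>. As \<open>t m t \<le> w t \<le> \<nu> U\<close>, \<open>m\<close> tends to \<open>0\<close> at infinity, hence so does \<open>w\<close> by absolute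
  continuity, and the density formula follows.
\<close>

section \<open>Integration by parts and measurability for antitonic functions\<close>

text \<open>On a uniform grid with \<open>Suc n\<close> steps of width \<open>h\<close> the bounds
  telescope to \<open>h * (m a - m b)\<close>, which tends to 0 as the grid is refined.\<close>

lemma eq_if_increments_bounded_by_antimono:
  fixes \<phi> m :: "real \<Rightarrow> real"
  assumes ab: "a \<le> b"
    and bd: "\<And>s t. a \<le> s \<Longrightarrow> s \<le> t \<Longrightarrow> t \<le> b \<Longrightarrow> \<bar>\<phi> t - \<phi> s\<bar> \<le> (t - s) * (m s - m t)"
  shows "\<phi> b = \<phi> a"
proof -
  have grid: "\<bar>\<phi> b - \<phi> a\<bar> \<le> (b - a) * (m a - m b) / real (Suc n)" for n
  proof -
    define h where "h = (b - a) / real (Suc n)"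
    define x where "x i = a + real i * h" for i
    have h: "h \<ge> 0" "real (Suc n) * h = b - a" using ab by (auto simp: h_def)
    have x: "a \<le> x i" "x i \<le> x (Suc i)" "x (Suc i) - x i = h" for i
      using h(1) by (auto simp: x_def algebra_simps)
    have xb: "x (Suc i) \<le> b" if "i < Suc n" for i
    proof -
      have "real (Suc i) * h \<le> real (Suc n) * h" using h(1) that by (intro mult_right_mono) auto
      then show ?thesis using h(2) by (simp add: x_def)
    qed
    have ends: "x 0 = a" "x (Suc n) = b" using h(2) by (auto simp: x_def)
    have "\<phi> b - \<phi> a = (\<Sum>i<Suc n. \<phi> (x (Suc i)) - \<phi> (x i))"
      using sum_lessThan_telescope[of "\<lambda>i. \<phi> (x i)" "Suc n"] by (simp only: ends)
    also have "\<bar>\<dots>\<bar> \<le> (\<Sum>i<Suc n. \<bar>\<phi> (x (Suc i)) - \<phi> (x i)\<bar>)" by (rule sum_abs)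
    also have "\<dots> \<le> (\<Sum>i<Suc n. h * (m (x i) - m (x (Suc i))))"
    proof (rule sum_mono)
      fix i assume "i \<in> {..<Suc n}"
      then show "\<bar>\<phi> (x (Suc i)) - \<phi> (x i)\<bar> \<le> h * (m (x i) - m (x (Suc i)))"
        using bd[OF x(1) x(2) xb, of i] x(3)[of i] by simp
    qed
    also have "\<dots> = h * (m a - m b)"
      using sum_lessThan_telescope'[of "\<lambda>i. m (x i)" "Suc n"]
      by (simp only: ends sum_distrib_left[symmetric])
    finally show ?thesis by (simp add: h_def)
  qed
  have "(\<lambda>n. (b - a) * (m a - m b) / real (Suc n)) \<longlonglongrightarrow> 0"
    by (rule LIMSEQ_Suc) (rule lim_const_over_n)
  from LIMSEQ_le_const[OF this] grid have "\<bar>\<phi> b - \<phi> a\<bar> \<le> 0" by blast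
  then show ?thesis by simp
qed

text \<open>
  The hypotheses on \<open>v\<close> say that \<open>dv = t dm\<close> in the sense of Stieltjes; the conclusion is integration
  by parts.
\<close>

lemma integral_antimono_by_parts:
  fixes m v :: "real \<Rightarrow> real"
  assumes ab: "a \<le> b"
    and anti: "\<And>s t. a \<le> s \<Longrightarrow> s \<le> t \<Longrightarrow> t \<le> b \<Longrightarrow> m t \<le> m s"
    and lo: "\<And>s t. a \<le> s \<Longrightarrow> s \<le> t \<Longrightarrow> t \<le> b \<Longrightarrow> s * (m s - m t) \<le> v s - v t"
    and hi: "\<And>s t. a \<le> s \<Longrightarrow> s \<le> t \<Longrightarrow> t \<le> b \<Longrightarrow> v s - v t \<le> t * (m s - m t)"
  shows "m integrable_on {a..b}" "integral {a..b} m = (v a - a * m a) - (v b - b * m b)"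
proof -
  have "mono_on {a..b} (\<lambda>t. - m t)" by (rule mono_onI) (use anti in auto)
  from integrable_neg[OF integrable_on_mono_on[OF this]]
  show int: "m integrable_on {a..b}" by simp
  \<comment> \<open>By \<open>lo\<close> and \<open>hi\<close>, the increment of
    \<open>v t - t * m t\<close> over \<open>{s..t}\<close> lies between
    \<open>-(t - s) * m s\<close> and \<open>-(t - s) * m t\<close>; that of the integral lies
    between \<open>(t - s) * m t\<close> and \<open>(t - s) * m s\<close>. Their sum is the small
    increment that the grid argument wants.\<close>
  define \<phi> where "\<phi> t = v t - t * m t + integral {a..t} m" for t
  have "\<phi> b = \<phi> a"
  proof (rule eq_if_increments_bounded_by_antimono[OF ab, where m = m])
    fix s t assume st: "a \<le> s" "s \<le> t" "t \<le> b"
    have ist: "m integrable_on {s..t}" "m integrable_on {a..t}"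
      using st by (auto intro: integrable_subinterval_real[OF int])
    have split: "integral {a..t} m = integral {a..s} m + integral {s..t} m"
      using Henstock_Kurzweil_Integration.integral_combine[OF st(1,2) ist(2)] by simp
    have "integral {s..t} m \<le> integral {s..t} (\<lambda>_. m s)"
      using st anti by (intro integral_le ist) auto
    moreover have "integral {s..t} (\<lambda>_. m t) \<le> integral {s..t} m"
      using st anti by (intro integral_le ist) auto
    ultimately have "integral {s..t} m \<le> (t - s) * m s" "(t - s) * m t \<le> integral {s..t} m"
      using st by auto
    then show "\<bar>\<phi> t - \<phi> s\<bar> \<le> (t - s) * (m s - m t)"
      using lo[OF st] hi[OF st] unfolding \<phi>_def split by (simp add: abs_le_iff algebra_simps)
  qed
  then show "integral {a..b} m = (v a - a * m a) - (v b - b * m b)" by (simp add: \<phi>_def)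
qed

text \<open>Superlevel sets are intervals: the indicator confines them to the positive arguments,
  where \<open>f\<close> is antitonic.\<close>

lemma borel_measurable_antimono_pos:
  fixes f :: "real \<Rightarrow> ennreal"
  assumes anti: "\<And>s t. 0 < s \<Longrightarrow> s \<le> t \<Longrightarrow> f t \<le> f s"
  shows "(\<lambda>t. f t * indicator {0<..} t) \<in> borel_measurable borel"
proof (rule borel_measurableI_greater)
  fix y
  have "is_interval {t. y < f t * indicator {0<..} t}"
    unfolding is_interval_1
  proof (intro ballI allI impI)
    fix s u t assume *: "s \<in> {t. y < f t * indicator {0<..} t}" "u \<in> {t. y < f t * indicator {0<..} t}"
      "s \<le> t \<and> t \<le> u"
    then have "0 < s" by (cases "0 < s") auto
    with * have "0 < t" "y < f u" by auto
    with * have "y < f t" using anti[of t u] by (auto intro: less_le_trans)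
    with \<open>0 < t\<close> show "t \<in> {t. y < f t * indicator {0<..} t}" by simp
  qed
  then show "{t \<in> space borel. y < f t * indicator {0<..} t} \<in> sets borel"
    using real_interval_borel_measurable by simp
qed

section \<open>Valuations and their real-valued differences\<close>

lemma countable_UN_in_omega_topological_space:
  assumes "omega_topological_space X L" "\<And>n::nat. U n \<in> L"
  shows "(\<Union>n. U n) \<in> L"
  using assms unfolding omega_topological_space_def by blast

lemma valuation_mono:
  assumes "valuation L \<mu>" "A \<in> L" "B \<in> L" "A \<subseteq> B"
  shows "\<mu> A \<le> \<mu> B"
  using assms unfolding valuation_def by blast

lemma valuation_modular:
  assumes "valuation L \<mu>" "A \<in> L" "B \<in> L"
  shows "\<mu> A + \<mu> B = \<mu> (A \<union> B) + \<mu> (A \<inter> B)"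
  using assms unfolding valuation_def by blast

lemma enn2real_valuation_mono:
  assumes "valuation L \<mu>" "A \<in> L" "B \<in> L" "A \<subseteq> B" "\<mu> B < \<infinity>"
  shows "enn2real (\<mu> A) \<le> enn2real (\<mu> B)"
  using valuation_mono[OF assms(1-4)] assms(5) by (simp add: enn2real_mono)

lemma enn2real_valuation_modular:
  assumes L: "lattice_of_sets X L" and v: "valuation L \<mu>" and AB: "A \<in> L" "B \<in> L"
    and fin: "\<mu> A < \<infinity>" "\<mu> B < \<infinity>"
  shows "enn2real (\<mu> A) + enn2real (\<mu> B) = enn2real (\<mu> (A \<union> B)) + enn2real (\<mu> (A \<inter> B))"
proof -
  note mod = valuation_modular[OF v AB]
  then have "\<mu> (A \<union> B) + \<mu> (A \<inter> B) < \<infinity>" using fin by (metis ennreal_add_less_top infinity_ennreal_def)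
  then have "\<mu> (A \<union> B) < top" "\<mu> (A \<inter> B) < top" by (auto simp: less_top)
  then show ?thesis using mod fin by (simp flip: enn2real_plus)
qed

text \<open>Modularity for \<open>A \<inter> E\<close> and \<open>B\<close>, whose union is
  \<open>A\<close> because \<open>E\<close> covers \<open>A - B\<close>. So a crescent inside
  \<open>E\<close> keeps its value when both sets presenting it are cut by \<open>E\<close>.\<close>

lemma enn2real_valuation_diff_Int:
  assumes L: "lattice_of_sets X L" and v: "valuation L \<mu>" and AB: "A \<in> L" "B \<in> L" "B \<subseteq> A"
    and E: "E \<in> L" "A - B \<subseteq> E" and fin: "\<mu> A < \<infinity>"
  shows "enn2real (\<mu> A) - enn2real (\<mu> B) = enn2real (\<mu> (A \<inter> E)) - enn2real (\<mu> (B \<inter> E))"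
proof -
  have AE: "A \<inter> E \<in> L" using L AB E by (simp add: lattice_of_sets_def)
  have "\<mu> (A \<inter> E) < \<infinity>" "\<mu> B < \<infinity>"
    using valuation_mono[OF v AE AB(1)] valuation_mono[OF v AB(2,1,3)] fin
    by (auto intro: le_less_trans)
  from enn2real_valuation_modular[OF L v AE AB(2) this]
  have "enn2real (\<mu> (A \<inter> E)) + enn2real (\<mu> B)
      = enn2real (\<mu> (A \<inter> E \<union> B)) + enn2real (\<mu> (A \<inter> E \<inter> B))" .
  moreover have "A \<inter> E \<union> B = A" "A \<inter> E \<inter> B = B \<inter> E" using AB(3) E(2) by auto
  ultimately show ?thesis by simp
qed

lemma omega_continuous_enn2real_tendsto:
  assumes v: "valuation L \<mu>" and c: "omega_continuous L \<mu>" and S: "\<And>n. S n \<in> L" "incseq S" "(\<Union>n. S n) \<in> L"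
    and fin: "\<mu> (\<Union>n. S n) < \<infinity>"
  shows "(\<lambda>n. enn2real (\<mu> (S n))) \<longlonglongrightarrow> enn2real (\<mu> (\<Union>n. S n))"
proof -
  have "incseq (\<lambda>n. \<mu> (S n))"
    using S(2) by (auto simp: incseq_def intro!: valuation_mono[OF v S(1) S(1)])
  then have "(\<lambda>n. \<mu> (S n)) \<longlonglongrightarrow> (SUP n. \<mu> (S n))" by (rule LIMSEQ_SUP)
  also have "(SUP n. \<mu> (S n)) = \<mu> (\<Union>n. S n)"
    using c S unfolding omega_continuous_def by metis
  finally show ?thesis using fin by (intro tendsto_enn2real) auto
qed

section \<open>Hahn decompositions as inequalities on crescents\<close>

text \<open>\<open>U\<close> is the positive part of a Hahn decomposition of \<open>\<nu> - r \<cdot> \<mu>\<close> on the crescents contained in \<open>E\<close>.\<close>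

definition hahn_set ::
    "'a set set \<Rightarrow> ('a set \<Rightarrow> ennreal) \<Rightarrow> ('a set \<Rightarrow> ennreal) \<Rightarrow> 'a set \<Rightarrow> real \<Rightarrow> 'a set \<Rightarrow> bool" where
  "hahn_set L \<nu> \<mu> E r U \<longleftrightarrow> (\<forall>A\<in>L. \<forall>B\<in>L. B \<subseteq> A \<longrightarrow> A \<subseteq> E \<longrightarrow>
     (A - B \<subseteq> U \<longrightarrow>
       r * (enn2real (\<mu> A) - enn2real (\<mu> B)) \<le> enn2real (\<nu> A) - enn2real (\<nu> B)) \<and>
     ((A - B) \<inter> U = {} \<longrightarrow>
       enn2real (\<nu> A) - enn2real (\<nu> B) \<le> r * (enn2real (\<mu> A) - enn2real (\<mu> B))))"

text \<open>Finiteness on \<open>E\<close> makes modularity an equation between reals, so the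
  difference is a signed valuation and the chosen extension has its explicit form on
  crescents.\<close>

lemma signed_ext_diff_crescent:
  assumes L: "lattice_of_sets X L" and v: "valuation L \<mu>" "valuation L \<nu>" and E: "E \<in> L"
    and fin: "\<mu> E < \<infinity>" "\<nu> E < \<infinity>" and AB: "A \<in> L" "B \<in> L"
  shows "signed_ext X L (signed_diff (restr \<nu> E) r (restr \<mu> E)) (A - B) =
    (enn2real (\<nu> (A \<inter> E)) - enn2real (\<nu> (A \<inter> B \<inter> E)))
    - r * (enn2real (\<mu> (A \<inter> E)) - enn2real (\<mu> (A \<inter> B \<inter> E)))"
proof -
  have mod: "enn2real (\<rho> (U \<inter> E)) + enn2real (\<rho> (V \<inter> E))
      = enn2real (\<rho> ((U \<union> V) \<inter> E)) + enn2real (\<rho> (U \<inter> V \<inter> E))"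
    if "valuation L \<rho>" "\<rho> E < \<infinity>" "U \<in> L" "V \<in> L" for \<rho> U V
  proof -
    have i: "U \<inter> E \<in> L" "V \<inter> E \<in> L" using L E that by (auto simp: lattice_of_sets_def)
    have "\<rho> (U \<inter> E) < \<infinity>" "\<rho> (V \<inter> E) < \<infinity>"
      using valuation_mono[OF that(1) i(1) E] valuation_mono[OF that(1) i(2) E] that(2)
      by (auto intro: le_less_trans)
    moreover have "(U \<inter> E) \<union> (V \<inter> E) = (U \<union> V) \<inter> E" "(U \<inter> E) \<inter> (V \<inter> E) = U \<inter> V \<inter> E" by auto
    ultimately show ?thesis using enn2real_valuation_modular[OF L that(1) i] by simp
  qed
  have "signed_valuation L (signed_diff (restr \<nu> E) r (restr \<mu> E))"
    unfolding signed_valuation_def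
  proof (intro conjI ballI)
    show "signed_diff (restr \<nu> E) r (restr \<mu> E) {} = 0"
      using v by (simp add: signed_diff_def restr_def valuation_def)
    fix U V assume UV: "U \<in> L" "V \<in> L"
    have "r * enn2real (\<mu> (U \<inter> E)) + r * enn2real (\<mu> (V \<inter> E))
      = r * enn2real (\<mu> ((U \<union> V) \<inter> E)) + r * enn2real (\<mu> (U \<inter> V \<inter> E))"
      using mod[OF v(1) fin(1) UV] by (metis distrib_left)
    then show "signed_diff (restr \<nu> E) r (restr \<mu> E) U + signed_diff (restr \<nu> E) r (restr \<mu> E) V
      = signed_diff (restr \<nu> E) r (restr \<mu> E) (U \<union> V)
      + signed_diff (restr \<nu> E) r (restr \<mu> E) (U \<inter> V)"
      using mod[OF v(2) fin(2) UV] by (simp add: signed_diff_def restr_def)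
  qed
  from signed_ext_crescent[OF L this AB] show ?thesis
    by (simp add: signed_diff_def restr_def algebra_simps)
qed

text \<open>The restricted valuations see a crescent only through its trace on \<open>E\<close>,
  which is again a crescent, presented by sets inside \<open>E\<close>. Hence a Hahn set may be cut
  by \<open>E\<close>, and one for the crescents inside \<open>E\<close> serves for all.\<close>

lemma hahn_decomposition_property_iff_hahn_set:
  assumes L: "lattice_of_sets X L" and v: "valuation L \<mu>" "valuation L \<nu>" and E: "E \<in> L"
    and fin: "\<mu> E < \<infinity>" "\<nu> E < \<infinity>"
  shows "hahn_decomposition_property X L (signed_diff (restr \<nu> E) r (restr \<mu> E))
    \<longleftrightarrow> (\<exists>U\<in>L. U \<subseteq> E \<and> hahn_set L \<nu> \<mu> E r U)"
proof -
  note ext = signed_ext_diff_crescent[OF L v E fin]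
  have Int: "A \<inter> B \<in> L" if "A \<in> L" "B \<in> L" for A B using L that by (auto simp: lattice_of_sets_def)
  show ?thesis
  proof
    assume "hahn_decomposition_property X L (signed_diff (restr \<nu> E) r (restr \<mu> E))"
    then obtain U where U: "U \<in> L"
      and pos': "\<And>C. C \<in> crescents L \<Longrightarrow> C \<subseteq> U \<Longrightarrow>
        0 \<le> signed_ext X L (signed_diff (restr \<nu> E) r (restr \<mu> E)) C"
      and neg': "\<And>C. C \<in> crescents L \<Longrightarrow> C \<inter> U = {} \<Longrightarrow>
        signed_ext X L (signed_diff (restr \<nu> E) r (restr \<mu> E)) C \<le> 0"
      unfolding hahn_decomposition_property_def by metis
    have cr: "A - B \<in> crescents L" if "A \<in> L" "B \<in> L" for A B
      using that by (auto simp: crescents_def)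
    note pos = pos'[OF cr] and neg = neg'[OF cr]
    have "hahn_set L \<nu> \<mu> E r (U \<inter> E)"
      unfolding hahn_set_def
    proof (intro ballI impI)
      fix A B assume AB: "A \<in> L" "B \<in> L" "B \<subseteq> A" "A \<subseteq> E"
      have eq: "A \<inter> E = A" "A \<inter> B \<inter> E = B" using AB by auto
      show "(A - B \<subseteq> U \<inter> E \<longrightarrow>
          r * (enn2real (\<mu> A) - enn2real (\<mu> B)) \<le> enn2real (\<nu> A) - enn2real (\<nu> B)) \<and>
        ((A - B) \<inter> (U \<inter> E) = {} \<longrightarrow>
          enn2real (\<nu> A) - enn2real (\<nu> B) \<le> r * (enn2real (\<mu> A) - enn2real (\<mu> B)))"
      proof (intro conjI impI)
        assume "A - B \<subseteq> U \<inter> E"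
        then show "r * (enn2real (\<mu> A) - enn2real (\<mu> B)) \<le> enn2real (\<nu> A) - enn2real (\<nu> B)"
          using pos[OF AB(1,2)] ext[OF AB(1,2), of r] by (simp add: eq)
      next
        assume "(A - B) \<inter> (U \<inter> E) = {}"
        then have "(A - B) \<inter> U = {}" using AB by auto
        then show "enn2real (\<nu> A) - enn2real (\<nu> B) \<le> r * (enn2real (\<mu> A) - enn2real (\<mu> B))"
          using neg[OF AB(1,2)] ext[OF AB(1,2), of r] by (simp add: eq)
      qed
    qed
    then show "\<exists>U\<in>L. U \<subseteq> E \<and> hahn_set L \<nu> \<mu> E r U" using Int[OF U E] by blast
  next
    assume "\<exists>U\<in>L. U \<subseteq> E \<and> hahn_set L \<nu> \<mu> E r U"
    then obtain U where U: "U \<in> L" "hahn_set L \<nu> \<mu> E r U" by blast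
    show "hahn_decomposition_property X L (signed_diff (restr \<nu> E) r (restr \<mu> E))"
      unfolding hahn_decomposition_property_def
    proof (intro bexI[OF _ U(1)] conjI ballI impI)
      fix C assume "C \<in> crescents L" and C: "C \<subseteq> U"
      then obtain A B where AB: "A \<in> L" "B \<in> L" "C = A - B" by (auto simp: crescents_def)
      have "A \<inter> E \<in> L" "A \<inter> B \<inter> E \<in> L" "A \<inter> B \<inter> E \<subseteq> A \<inter> E" "A \<inter> E \<subseteq> E" "A \<inter> E - A \<inter> B \<inter> E \<subseteq> U"
        using AB E C Int by auto
      then show "0 \<le> signed_ext X L (signed_diff (restr \<nu> E) r (restr \<mu> E)) C"
        using U(2) unfolding AB(3) ext[OF AB(1,2)] hahn_set_def by fastforce
    next
      fix C assume "C \<in> crescents L" and C: "C \<inter> U = {}"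
      then obtain A B where AB: "A \<in> L" "B \<in> L" "C = A - B" by (auto simp: crescents_def)
      have "A \<inter> E \<in> L" "A \<inter> B \<inter> E \<in> L" "A \<inter> B \<inter> E \<subseteq> A \<inter> E" "A \<inter> E \<subseteq> E"
        "(A \<inter> E - A \<inter> B \<inter> E) \<inter> U = {}"
        using AB E C Int by auto
      then show "signed_ext X L (signed_diff (restr \<nu> E) r (restr \<mu> E)) C \<le> 0"
        using U(2) unfolding AB(3) ext[OF AB(1,2)] hahn_set_def by fastforce
    qed
  qed
qed

text \<open>Since \<open>A - B \<subseteq> U \<subseteq> E\<close>, cutting \<open>A\<close> and
  \<open>B\<close> by \<open>E\<close> changes no difference. This frees the positive half from
  \<open>A \<subseteq> E\<close>, so that Hahn sets belonging to different \<open>E\<close> can act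
  on one crescent.\<close>

lemma hahn_set_pos:
  assumes L: "lattice_of_sets X L" and v: "valuation L \<mu>" "valuation L \<nu>"
    and U: "hahn_set L \<nu> \<mu> E r U" "U \<subseteq> E" "E \<in> L"
    and AB: "A \<in> L" "B \<in> L" "B \<subseteq> A" "A - B \<subseteq> U" and fin: "\<mu> A < \<infinity>" "\<nu> A < \<infinity>"
  shows "r * (enn2real (\<mu> A) - enn2real (\<mu> B)) \<le> enn2real (\<nu> A) - enn2real (\<nu> B)"
proof -
  have "A - B \<subseteq> E" using AB U by auto
  note eq = enn2real_valuation_diff_Int[OF L v(1) AB(1-3) U(3) this fin(1)]
    enn2real_valuation_diff_Int[OF L v(2) AB(1-3) U(3) this fin(2)]
  have "A \<inter> E \<in> L" "B \<inter> E \<in> L" "B \<inter> E \<subseteq> A \<inter> E" "A \<inter> E \<subseteq> E" "A \<inter> E - B \<inter> E \<subseteq> U"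
    using L AB U by (auto simp: lattice_of_sets_def)
  then show ?thesis using U(1) unfolding eq hahn_set_def by blast
qed

text \<open>The sets \<open>S k\<close> climb from \<open>B\<close> to \<open>A\<close>, and each
  increment \<open>S (Suc k) - S k\<close> is a crescent inside the single set \<open>W k\<close>.
  The inequalities telescope, and \<omega>-continuity carries them to the limit.\<close>

lemma hahn_set_UN_pos:
  assumes X: "omega_topological_space X L"
    and v: "valuation L \<mu>" "valuation L \<nu>" and c: "omega_continuous L \<mu>" "omega_continuous L \<nu>"
    and W: "\<And>k::nat. W k \<in> L"
    and pos: "\<And>k A B. A \<in> L \<Longrightarrow> B \<in> L \<Longrightarrow> B \<subseteq> A \<Longrightarrow> A - B \<subseteq> W k \<Longrightarrow> \<mu> A < \<infinity> \<Longrightarrow> \<nu> A < \<infinity> \<Longrightarrow>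
      t * (enn2real (\<mu> A) - enn2real (\<mu> B)) \<le> enn2real (\<nu> A) - enn2real (\<nu> B)"
    and AB: "A \<in> L" "B \<in> L" "B \<subseteq> A" "A - B \<subseteq> (\<Union>k. W k)" and fin: "\<mu> A < \<infinity>" "\<nu> A < \<infinity>"
  shows "t * (enn2real (\<mu> A) - enn2real (\<mu> B)) \<le> enn2real (\<nu> A) - enn2real (\<nu> B)"
proof -
  have L: "lattice_of_sets X L" using X by (simp add: omega_topological_space_def)
  have Int: "A \<inter> B \<in> L" and Un: "A \<union> B \<in> L" if "A \<in> L" "B \<in> L" for A B
    using L that by (auto simp: lattice_of_sets_def)
  define S where "S k = B \<union> (A \<inter> (\<Union>i<k. W i))" for k
  have SL: "S k \<in> L" for k
  proof (induction k)
    case 0 then show ?case using AB by (simp add: S_def)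
  next
    case (Suc k)
    have "S (Suc k) = S k \<union> (A \<inter> W k)" by (auto simp: S_def lessThan_Suc)
    then show ?case using Suc Int Un AB W by simp
  qed
  have SA: "S k \<subseteq> A" for k using AB by (auto simp: S_def)
  have inc: "incseq S" by (rule incseq_SucI) (auto simp: S_def lessThan_Suc)
  have US: "(\<Union>k. S k) = A"
  proof
    show "A \<subseteq> (\<Union>k. S k)"
    proof
      fix x assume x: "x \<in> A"
      show "x \<in> (\<Union>k. S k)"
      proof (cases "x \<in> B")
        case False
        then obtain k where "x \<in> W k" using x AB(4) by blast
        then have "x \<in> S (Suc k)" using x by (auto simp: S_def)
        then show ?thesis by blast
      qed (auto simp: S_def)
    qed
  qed (use SA in blast)
  have finS: "\<mu> (S k) < \<infinity>" "\<nu> (S k) < \<infinity>" for k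
    using valuation_mono[OF v(1) SL AB(1) SA] valuation_mono[OF v(2) SL AB(1) SA] fin
    by (auto intro: le_less_trans)
  have step: "t * (enn2real (\<mu> (S k)) - enn2real (\<mu> B)) \<le> enn2real (\<nu> (S k)) - enn2real (\<nu> B)" for k
  proof (induction k)
    case 0 then show ?case by (simp add: S_def)
  next
    case (Suc k)
    have "S (Suc k) - S k \<subseteq> W k" by (auto simp: S_def lessThan_Suc)
    from pos[OF SL SL _ this finS] inc
    have "t * (enn2real (\<mu> (S (Suc k))) - enn2real (\<mu> (S k)))
        \<le> enn2real (\<nu> (S (Suc k))) - enn2real (\<nu> (S k))"
      by (simp add: incseq_Suc_iff)
    with Suc show ?case by (simp add: algebra_simps)
  qed
  have lim: "(\<lambda>k. enn2real (\<mu> (S k))) \<longlonglongrightarrow> enn2real (\<mu> A)" "(\<lambda>k. enn2real (\<nu> (S k))) \<longlonglongrightarrow> enn2real (\<nu> A)"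
    using omega_continuous_enn2real_tendsto[OF v(1) c(1) SL inc]
      omega_continuous_enn2real_tendsto[OF v(2) c(2) SL inc] fin AB by (simp_all add: US)
  show ?thesis
    by (rule LIMSEQ_le[of "\<lambda>k. t * (enn2real (\<mu> (S k)) - enn2real (\<mu> B))" _
          "\<lambda>k. enn2real (\<nu> (S k)) - enn2real (\<nu> B)"])
       (use step in \<open>auto intro!: tendsto_intros lim\<close>)
qed

section \<open>Properties of valuations that have a density\<close>

text \<open>The superlevel sets of \<open>indicator U x * g x\<close> are the traces on
  \<open>U\<close> of those of \<open>g\<close>. Passing from the Riemann to the Lebesgue integral
  makes monotone convergence available.\<close>

lemma density_valuation_eq_nn_integral:
  assumes L: "lattice_of_sets X L" and v: "valuation L \<mu>" and g: "g \<in> measurable_maps X L" and U: "U \<in> L"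
  shows "density_valuation X g \<mu> U = (\<integral>\<^sup>+t\<in>{0<..}. \<mu> (U \<inter> {x\<in>X. ennreal t < g x}) \<partial>lborel)"
    and "density_valuation X g \<mu> U = improper_integral (\<lambda>t. \<mu> (U \<inter> {x\<in>X. ennreal t < g x}))"
    and "(\<lambda>t. \<mu> (U \<inter> {x\<in>X. ennreal t < g x}) * indicator {0<..} t) \<in> borel_measurable borel"
proof -
  have anti: "\<mu> (U \<inter> {x\<in>X. ennreal t < g x}) \<le> \<mu> (U \<inter> {x\<in>X. ennreal s < g x})"
    if "0 < s" "s \<le> t" for s t
  proof (rule valuation_mono[OF v])
    show "U \<inter> {x\<in>X. ennreal t < g x} \<subseteq> U \<inter> {x\<in>X. ennreal s < g x}"
      using that by (auto intro: le_less_trans[OF ennreal_leI])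
  qed (use g U L that in \<open>auto simp: lattice_of_sets_def measurable_maps_def\<close>)
  have "U \<subseteq> X" using L U by (auto simp: lattice_of_sets_def)
  then have eq: "{x\<in>X. ennreal t < indicator U x * g x} = U \<inter> {x\<in>X. ennreal t < g x}" for t
    by (auto simp: indicator_def split: if_splits)
  show "density_valuation X g \<mu> U = improper_integral (\<lambda>t. \<mu> (U \<inter> {x\<in>X. ennreal t < g x}))"
    by (simp add: density_valuation_def choquet_integral_def eq)
  then show "density_valuation X g \<mu> U = (\<integral>\<^sup>+t\<in>{0<..}. \<mu> (U \<inter> {x\<in>X. ennreal t < g x}) \<partial>lborel)"
    using improper_integral_eq_nn_integral[of "\<lambda>t. \<mu> (U \<inter> {x\<in>X. ennreal t < g x})", OF anti] by simp
  show "(\<lambda>t. \<mu> (U \<inter> {x\<in>X. ennreal t < g x}) * indicator {0<..} t) \<in> borel_measurable borel"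
    by (rule borel_measurable_antimono_pos) (rule anti)
qed

text \<open>Two monotone limits: \<omega>-continuity of \<open>\<mu>\<close> at each height
  \<open>t\<close>, then monotone convergence in \<open>t\<close>.\<close>

lemma density_valuation_omega_continuous:
  assumes X: "omega_topological_space X L" and v: "valuation L \<mu>" and c: "omega_continuous L \<mu>"
    and g: "g \<in> measurable_maps X L"
  shows "omega_continuous L (density_valuation X g \<mu>)"
  unfolding omega_continuous_def
proof (intro allI impI)
  fix U :: "nat \<Rightarrow> 'a set" assume U: "\<forall>n. U n \<in> L" "incseq U"
  have L: "lattice_of_sets X L" using X by (simp add: omega_topological_space_def)
  have UL: "(\<Union>n. U n) \<in> L" using countable_UN_in_omega_topological_space[OF X] U by blast
  let ?f = "\<lambda>A t. \<mu> (A \<inter> {x\<in>X. ennreal t < g x}) * indicator {0<..} t"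
  have in_L: "U n \<inter> {x\<in>X. ennreal t < g x} \<in> L" if "t > 0" for n t
    using that U L g by (auto simp: lattice_of_sets_def measurable_maps_def)
  have inc: "incseq (\<lambda>n. ?f (U n))"
  proof (rule incseq_SucI, rule le_funI)
    fix n t
    show "?f (U n) t \<le> ?f (U (Suc n)) t"
    proof (cases "t > 0")
      case True
      have "U n \<inter> {x\<in>X. ennreal t < g x} \<subseteq> U (Suc n) \<inter> {x\<in>X. ennreal t < g x}"
        using U(2) by (auto simp: incseq_Suc_iff)
      then show ?thesis using valuation_mono[OF v in_L in_L] True by simp
    qed simp
  qed
  have eq: "?f (\<Union>n. U n) t = (SUP n. ?f (U n) t)" for t
  proof (cases "t > 0")
    case True
    have "incseq (\<lambda>n. U n \<inter> {x\<in>X. ennreal t < g x})" using U(2) by (fastforce simp: incseq_def)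
    then have "\<mu> (\<Union>n. U n \<inter> {x\<in>X. ennreal t < g x}) = (SUP n. \<mu> (U n \<inter> {x\<in>X. ennreal t < g x}))"
      using c[unfolded omega_continuous_def, rule_format, of "\<lambda>n. U n \<inter> {x\<in>X. ennreal t < g x}"]
        in_L[OF True] by blast
    moreover have "(\<Union>n. U n) \<inter> {x\<in>X. ennreal t < g x} = (\<Union>n. U n \<inter> {x\<in>X. ennreal t < g x})" by blast
    ultimately have "\<mu> ((\<Union>n. U n) \<inter> {x\<in>X. ennreal t < g x}) = (SUP n. \<mu> (U n \<inter> {x\<in>X. ennreal t < g x}))"
      by (simp only:)
    moreover have "indicator {0<..} t = (1::ennreal)" using True by simp
    ultimately show ?thesis by (simp only: mult_1_right)
  qed simp
  have "density_valuation X g \<mu> (\<Union>n. U n) = (\<integral>\<^sup>+t. (SUP n. ?f (U n) t) \<partial>lborel)"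
    unfolding density_valuation_eq_nn_integral(1)[OF L v g UL] by (rule nn_integral_cong) (rule eq)
  also have "\<dots> = (SUP n. \<integral>\<^sup>+t. ?f (U n) t \<partial>lborel)"
    using density_valuation_eq_nn_integral(3)[OF L v g] U(1)
    by (intro nn_integral_monotone_convergence_SUP[OF inc]) simp
  also have "\<dots> = (SUP n. density_valuation X g \<mu> (U n))"
    using density_valuation_eq_nn_integral(1)[OF L v g] U(1) by simp
  finally show "density_valuation X g \<mu> (\<Union>n. U n) = (SUP n. density_valuation X g \<mu> (U n))" .
qed

text \<open>Split the integral over heights at a large \<open>n\<close>. The part above
  \<open>n\<close> is controlled by the tail for \<open>U0\<close>, uniformly in
  \<open>U \<subseteq> U0\<close>; the part below is at most \<open>n\<close> times
  \<open>\<mu> U\<close>.\<close>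

lemma density_valuation_abs_continuous:
  assumes L: "lattice_of_sets X L" and v: "valuation L \<mu>" and g: "g \<in> measurable_maps X L"
    and dens: "\<And>U. U \<in> L \<Longrightarrow> \<nu> U = density_valuation X g \<mu> U"
  shows "abs_continuous L \<nu> \<mu>"
  unfolding abs_continuous_def
proof (intro ballI impI allI)
  fix U0 :: "'a set" and \<epsilon> :: real
  assume U0: "U0 \<in> L" and fin: "\<nu> U0 < \<infinity>" and eps: "\<epsilon> > 0"
  define f where "f A t = \<mu> (A \<inter> {x\<in>X. ennreal t < g x}) * indicator {0<..} t" for A t
  have \<nu>: "\<nu> A = (\<integral>\<^sup>+t. f A t \<partial>lborel)" if "A \<in> L" for A
    using that by (simp add: dens f_def density_valuation_eq_nn_integral(1)[OF L v g])
  have f_meas: "f A \<in> borel_measurable borel" if "A \<in> L" for A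
    using density_valuation_eq_nn_integral(3)[OF L v g that] unfolding f_def .
  have split: "\<nu> A = (\<integral>\<^sup>+t. f A t * indicator {..real n} t \<partial>lborel) + (\<integral>\<^sup>+t. f A t * indicator {real n<..} t \<partial>lborel)"
    if A: "A \<in> L" for A n
    unfolding \<nu>[OF A] using f_meas[OF A]
    by (subst nn_integral_add[symmetric]) (auto intro!: nn_integral_cong simp: indicator_def)
  have in_L: "A \<inter> {x\<in>X. ennreal t < g x} \<in> L" if "A \<in> L" "t > 0" for A t
    using that L g by (auto simp: lattice_of_sets_def measurable_maps_def)
  have "\<nu> U0 = (\<integral>\<^sup>+t. (SUP n. f U0 t * indicator {..real n} t) \<partial>lborel)"
    unfolding \<nu>[OF U0]
  proof (rule nn_integral_cong, rule antisym)
    fix t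
    obtain n where "t \<le> real n" using real_arch_simple by blast
    then show "f U0 t \<le> (SUP n. f U0 t * indicator {..real n} t)" by (intro SUP_upper2[of n]) auto
    show "(SUP n. f U0 t * indicator {..real n} t) \<le> f U0 t"
      by (rule SUP_least) (simp add: indicator_def)
  qed
  also have "\<dots> = (SUP n. \<integral>\<^sup>+t. f U0 t * indicator {..real n} t \<partial>lborel)"
    using f_meas[OF U0]
    by (intro nn_integral_monotone_convergence_SUP) (auto simp: incseq_def le_fun_def indicator_def)
  finally have sup: "\<nu> U0 = (SUP n. \<integral>\<^sup>+t. f U0 t * indicator {..real n} t \<partial>lborel)" .
  \<comment> \<open>The margin is added to the supremum rather than subtracted from
    \<open>\<nu> U0\<close>; the finite lower part is cancelled afterwards to bound the
    tail.\<close>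
  have "\<nu> U0 < \<nu> U0 + ennreal (\<epsilon> / 2)"
    using fin eps by (simp add: less_top)
  also have "\<dots> = (SUP n. (\<integral>\<^sup>+t. f U0 t * indicator {..real n} t \<partial>lborel) + ennreal (\<epsilon> / 2))"
    by (subst sup) (rule ennreal_SUP_add_left[symmetric], simp)
  finally obtain n where n: "\<nu> U0 < (\<integral>\<^sup>+t. f U0 t * indicator {..real n} t \<partial>lborel) + ennreal (\<epsilon> / 2)"
    by (auto simp: less_SUP_iff)
  have "(\<integral>\<^sup>+t. f U0 t * indicator {..real n} t \<partial>lborel) \<le> \<nu> U0"
    using split[OF U0, of n] by simp
  then have "(\<integral>\<^sup>+t. f U0 t * indicator {..real n} t \<partial>lborel) \<noteq> \<infinity>" using fin by auto
  with n have tail: "(\<integral>\<^sup>+t. f U0 t * indicator {real n<..} t \<partial>lborel) < ennreal (\<epsilon> / 2)"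
    unfolding split[OF U0, of n] by (simp add: ennreal_add_left_cancel_less)
  \<comment> \<open>Chosen so that \<open>\<eta> * real n < \<epsilon> / 2\<close>; the added 1
    covers \<open>n = 0\<close>.\<close>
  define \<eta> where "\<eta> = \<epsilon> / (2 * (real n + 1))"
  show "\<exists>\<eta>>0. \<forall>U\<in>L. U \<subseteq> U0 \<longrightarrow> \<mu> U < ennreal \<eta> \<longrightarrow> \<nu> U < ennreal \<epsilon>"
  proof (intro exI[of _ \<eta>] conjI ballI impI)
    show "\<eta> > 0" using eps by (simp add: \<eta>_def)
    fix U assume U: "U \<in> L" "U \<subseteq> U0" "\<mu> U < ennreal \<eta>"
    obtain u where u: "\<mu> U = ennreal u" "0 \<le> u" "u < \<eta>"
      using U(3) by (cases "\<mu> U") (auto simp: ennreal_less_iff)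
    have "(\<integral>\<^sup>+t. f U t * indicator {..real n} t \<partial>lborel) \<le> (\<integral>\<^sup>+t. \<mu> U * indicator {0<..real n} t \<partial>lborel)"
      by (rule nn_integral_mono)
        (auto simp: f_def indicator_def intro!: valuation_mono[OF v] in_L U)
    also have "\<dots> = ennreal (u * real n)"
      using u by (subst nn_integral_cmult_indicator) (auto simp: ennreal_mult')
    finally have 1: "(\<integral>\<^sup>+t. f U t * indicator {..real n} t \<partial>lborel) \<le> ennreal (u * real n)" .
    have "(\<integral>\<^sup>+t. f U t * indicator {real n<..} t \<partial>lborel) \<le> (\<integral>\<^sup>+t. f U0 t * indicator {real n<..} t \<partial>lborel)"
      using U by (intro nn_integral_mono)
        (auto simp: f_def indicator_def intro!: valuation_mono[OF v] in_L U0)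
    then have "\<nu> U \<le> ennreal (u * real n) + ennreal (\<epsilon> / 2)"
      unfolding split[OF U(1), of n] using 1 tail by (intro add_mono) auto
    also have "\<dots> = ennreal (u * real n + \<epsilon> / 2)" using u eps by simp
    also have "\<dots> < ennreal \<epsilon>"
    proof (rule ennreal_lessI[OF eps])
      have "u * real n \<le> \<eta> * real n" using u by (intro mult_right_mono) auto
      also have "\<dots> < \<epsilon> / 2" using eps by (simp add: \<eta>_def field_simps)
      finally show "u * real n + \<epsilon> / 2 < \<epsilon>" by simp
    qed
    finally show "\<nu> U < ennreal \<epsilon>" .
  qed
qed

text \<open>Integral comparisons are made in additive form, since subtraction in
  \<open>ennreal\<close> truncates; finiteness then permits the rearrangement into real
  differences.\<close>

lemma enn2real_diff_leI:
  assumes "a + ennreal r * b \<le> c + ennreal r * d" "0 \<le> r" "a < \<infinity>" "b < \<infinity>" "c < \<infinity>" "d < \<infinity>"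
  shows "r * (enn2real b - enn2real d) \<le> enn2real c - enn2real a"
  using assms by (cases a; cases b; cases c; cases d)
    (auto simp: ennreal_mult'[symmetric] ennreal_plus[symmetric] algebra_simps simp del: ennreal_plus)

text \<open>With \<open>r * \<mu> B\<close> written as the integral of \<open>\<mu> B\<close> over
  \<open>{0<..r}\<close>, both halves become comparisons of integrands at each height
  \<open>t\<close>.\<close>

lemma density_valuation_hahn_set:
  assumes L: "lattice_of_sets X L" and v: "valuation L \<mu>" and g: "g \<in> measurable_maps X L"
    and dens: "\<And>U. U \<in> L \<Longrightarrow> \<nu> U = density_valuation X g \<mu> U"
    and E: "E \<in> L" "\<mu> E < \<infinity>" "\<nu> E < \<infinity>" and \<nu>: "valuation L \<nu>" and r: "0 \<le> r"
  shows "hahn_set L \<nu> \<mu> E r {x\<in>X. ennreal r < g x}"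
  unfolding hahn_set_def
proof (intro ballI impI)
  define G where "G t = {x\<in>X. ennreal t < g x}" for t
  define f where "f A t = \<mu> (A \<inter> G t) * indicator {0<..} t" for A t
  have GL: "G t \<in> L" if "t \<ge> 0" for t using g that by (simp add: G_def measurable_maps_def)
  have Ganti: "G t \<subseteq> G s" if "s \<le> t" for s t
    using that by (auto simp: G_def intro: le_less_trans[OF ennreal_leI])
  have Int: "A \<inter> B \<in> L" if "A \<in> L" "B \<in> L" for A B using L that by (auto simp: lattice_of_sets_def)
  have Un: "A \<union> B \<in> L" if "A \<in> L" "B \<in> L" for A B using L that by (auto simp: lattice_of_sets_def)
  have f_meas[measurable]: "f A \<in> borel_measurable borel" if "A \<in> L" for A
    using density_valuation_eq_nn_integral(3)[OF L v g that] unfolding f_def G_def .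
  have add: "(\<integral>\<^sup>+t. f A t + \<mu> B * indicator {0<..r} t \<partial>lborel) = \<nu> A + ennreal r * \<mu> B"
    if "A \<in> L" for A B
  proof -
    have "\<nu> A = (\<integral>\<^sup>+t. f A t \<partial>lborel)"
      using that by (simp add: dens f_def G_def density_valuation_eq_nn_integral(1)[OF L v g])
    then show ?thesis
      using f_meas[OF that] r by (simp add: nn_integral_add nn_integral_cmult_indicator mult.commute)
  qed
  fix A B assume AB: "A \<in> L" "B \<in> L" "B \<subseteq> A" "A \<subseteq> E"
  have "\<mu> A \<le> \<mu> E" "\<mu> B \<le> \<mu> E" "\<nu> A \<le> \<nu> E" "\<nu> B \<le> \<nu> E"
    using AB E by (auto intro!: valuation_mono[OF v] valuation_mono[OF \<nu>])
  then have fin: "\<mu> A < \<infinity>" "\<mu> B < \<infinity>" "\<nu> A < \<infinity>" "\<nu> B < \<infinity>"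
    using E(2,3) by (auto intro: le_less_trans)
  have mod: "\<mu> (A \<inter> G t) + \<mu> B = \<mu> (A \<inter> G t \<union> B) + \<mu> (B \<inter> G t)" if "t \<ge> 0" for t
  proof -
    have "A \<inter> G t \<inter> B = B \<inter> G t" using AB by auto
    then show ?thesis using valuation_modular[OF v Int[OF AB(1) GL[OF that]] AB(2)] by simp
  qed
  have mono: "\<mu> (B \<inter> G t) \<le> \<mu> (A \<inter> G t)" if "t \<ge> 0" for t
    using AB that by (intro valuation_mono[OF v] Int GL) auto
  have "r * (enn2real (\<mu> A) - enn2real (\<mu> B)) \<le> enn2real (\<nu> A) - enn2real (\<nu> B)"
    if C: "A - B \<subseteq> G r"
  proof (rule enn2real_diff_leI[OF _ r fin(4,1,3,2)])
    \<comment> \<open>For \<open>t \<le> r\<close> the crescent lies in \<open>G t\<close>, so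
      \<open>A \<inter> G t \<union> B = A\<close> and modularity gives equality; above
      \<open>r\<close> monotonicity suffices.\<close>
    have "f B t + \<mu> A * indicator {0<..r} t \<le> f A t + \<mu> B * indicator {0<..r} t" for t
    proof -
      have "\<mu> (B \<inter> G t) + \<mu> A \<le> \<mu> (A \<inter> G t) + \<mu> B" if t: "0 < t" "t \<le> r"
      proof -
        have "A \<inter> G t \<union> B = A" using C Ganti[OF t(2)] AB by auto
        then show ?thesis using mod[of t] t by (simp add: add.commute)
      qed
      then show ?thesis using mono[of t] by (auto simp: f_def indicator_def)
    qed
    then show "\<nu> B + ennreal r * \<mu> A \<le> \<nu> A + ennreal r * \<mu> B"
      unfolding add[OF AB(1), symmetric] add[OF AB(2), symmetric] by (rule nn_integral_mono)
  qed
  moreover have "enn2real (\<nu> A) - enn2real (\<nu> B) \<le> r * (enn2real (\<mu> A) - enn2real (\<mu> B))"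
    if C: "(A - B) \<inter> G r = {}"
  proof -
    \<comment> \<open>For \<open>t \<le> r\<close> the union
      \<open>A \<inter> G t \<union> B\<close> is only contained in \<open>A\<close>; from
      \<open>r\<close> on, \<open>G t\<close> misses the crescent, so \<open>A\<close> and
      \<open>B\<close> have the same trace on it.\<close>
    have "f A t + \<mu> B * indicator {0<..r} t \<le> f B t + \<mu> A * indicator {0<..r} t" for t
    proof -
      have "\<mu> (A \<inter> G t) + \<mu> B \<le> \<mu> (B \<inter> G t) + \<mu> A" if t: "0 < t" "t \<le> r"
      proof -
        have "\<mu> (A \<inter> G t \<union> B) \<le> \<mu> A"
          using AB t by (intro valuation_mono[OF v] Un Int GL) auto
        then show ?thesis using mod[of t] t by (metis add.commute add_left_mono less_imp_le)
      qed
      moreover have "A \<inter> G t = B \<inter> G t" if "r \<le> t" using C Ganti[OF that] AB by auto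
      ultimately show ?thesis by (auto simp: f_def indicator_def)
    qed
    then have "\<nu> A + ennreal r * \<mu> B \<le> \<nu> B + ennreal r * \<mu> A"
      unfolding add[OF AB(1), symmetric] add[OF AB(2), symmetric] by (rule nn_integral_mono)
    from enn2real_diff_leI[OF this r fin(3,2,4,1)] show ?thesis by (simp add: algebra_simps)
  qed
  ultimately show "(A - B \<subseteq> {x\<in>X. ennreal r < g x} \<longrightarrow>
      r * (enn2real (\<mu> A) - enn2real (\<mu> B)) \<le> enn2real (\<nu> A) - enn2real (\<nu> B)) \<and>
    ((A - B) \<inter> {x\<in>X. ennreal r < g x} = {} \<longrightarrow>
      enn2real (\<nu> A) - enn2real (\<nu> B) \<le> r * (enn2real (\<mu> A) - enn2real (\<mu> B)))"
    unfolding G_def by blast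
qed

section \<open>Construction of the density from Hahn sets\<close>

lemma hahn_sets_are_superlevel_sets:
  assumes X: "omega_topological_space X L"
    and v: "valuation L \<mu>" "valuation L \<nu>" and c: "omega_continuous L \<mu>" "omega_continuous L \<nu>"
    and E: "\<And>n::nat. E n \<in> L" "\<And>n. \<mu> (E n) < \<infinity>" "\<And>n. \<nu> (E n) < \<infinity>"
    and H: "\<And>n r. 0 \<le> r \<Longrightarrow> \<exists>U\<in>L. U \<subseteq> E n \<and> hahn_set L \<nu> \<mu> (E n) r U"
  obtains g where "g \<in> measurable_maps X L"
    and "\<And>n t. 0 \<le> t \<Longrightarrow> hahn_set L \<nu> \<mu> (E n) t {x\<in>X. ennreal t < g x}"
proof -
  have L: "lattice_of_sets X L" using X by (simp add: omega_topological_space_def)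
  obtain U where U: "\<And>n r. 0 \<le> r \<Longrightarrow> U n r \<in> L \<and> U n r \<subseteq> E n \<and> hahn_set L \<nu> \<mu> (E n) r (U n r)"
  proof -
    have "\<forall>n r. \<exists>U. 0 \<le> r \<longrightarrow> U \<in> L \<and> U \<subseteq> E n \<and> hahn_set L \<nu> \<mu> (E n) r U" using H by blast
    then show ?thesis using that by metis
  qed
  \<comment> \<open>Rational levels keep the family countable, so the unions below stay in
    \<open>L\<close>. The enumeration may repeat pairs; only its range matters.\<close>
  define I where "I = (UNIV :: nat set) \<times> (\<rat> \<inter> {0::real..})"
  have I: "countable I" "I \<noteq> {}" unfolding I_def by (auto intro: countable_rat intro!: exI[of _ 0])
  define e where "e = from_nat_into I"
  have range: "range e = I" unfolding e_def using range_from_nat_into[OF I(2,1)] .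
  define \<rho> where "\<rho> k = snd (e k)" for k
  define V where "V k = U (fst (e k)) (\<rho> k)" for k
  have \<rho>: "\<rho> k \<ge> 0" for k
  proof -
    have "e k \<in> I" using range by blast
    then show ?thesis by (auto simp: I_def \<rho>_def)
  qed
  have V: "V k \<in> L" "V k \<subseteq> E (fst (e k))" "hahn_set L \<nu> \<mu> (E (fst (e k))) (\<rho> k) (V k)" for k
    using U[OF \<rho>] by (auto simp: V_def)
  have VX: "V k \<subseteq> X" for k using V(1) L by (auto simp: lattice_of_sets_def)
  define g where "g x = (SUP k. ennreal (\<rho> k) * indicator (V k) x)" for x
  \<comment> \<open>Levels not above \<open>t\<close> contribute the empty set, so the union can run
    over all \<open>k\<close>.\<close>
  define W where "W t k = (if t < \<rho> k then V k else {})" for t k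
  have WL: "W t k \<in> L" for t k using V L by (auto simp: W_def lattice_of_sets_def)
  have G: "{x\<in>X. ennreal t < g x} = (\<Union>k. W t k)" if t: "0 \<le> t" for t
  proof -
    have "ennreal t < ennreal (\<rho> k) * indicator (V k) x \<longleftrightarrow> x \<in> W t k" for k x
      using t by (auto simp: W_def indicator_def ennreal_less_iff)
    moreover have "W t k \<subseteq> X" for k using VX by (auto simp: W_def)
    ultimately show ?thesis by (auto simp: g_def less_SUP_iff)
  qed
  have g: "g \<in> measurable_maps X L"
    unfolding measurable_maps_def using countable_UN_in_omega_topological_space[OF X WL] by (simp add: G)
  have "hahn_set L \<nu> \<mu> (E n) t {x\<in>X. ennreal t < g x}" if t: "0 \<le> t" for n t
    unfolding hahn_set_def G[OF t]
  proof (intro ballI impI conjI)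
    fix A B assume AB: "A \<in> L" "B \<in> L" "B \<subseteq> A" "A \<subseteq> E n"
    have fin: "\<mu> A < \<infinity>" "\<nu> A < \<infinity>"
      using valuation_mono[OF v(1) AB(1) E(1) AB(4)] valuation_mono[OF v(2) AB(1) E(1) AB(4)] E(2,3)
      by (auto intro: le_less_trans)
    have d: "0 \<le> enn2real (\<mu> A) - enn2real (\<mu> B)" using enn2real_valuation_mono[OF v(1) AB(2,1,3) fin(1)] by simp
    {
      assume C: "A - B \<subseteq> (\<Union>k. W t k)"
      show "t * (enn2real (\<mu> A) - enn2real (\<mu> B)) \<le> enn2real (\<nu> A) - enn2real (\<nu> B)"
      proof (rule hahn_set_UN_pos[OF X v c WL _ AB(1-3) C fin])
        fix k A B assume A: "A \<in> L" "B \<in> L" "B \<subseteq> A" "A - B \<subseteq> W t k" "\<mu> A < \<infinity>" "\<nu> A < \<infinity>"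
        show "t * (enn2real (\<mu> A) - enn2real (\<mu> B)) \<le> enn2real (\<nu> A) - enn2real (\<nu> B)"
        proof (cases "t < \<rho> k")
          case True
          have "t * (enn2real (\<mu> A) - enn2real (\<mu> B)) \<le> \<rho> k * (enn2real (\<mu> A) - enn2real (\<mu> B))"
            using True enn2real_valuation_mono[OF v(1) A(2,1,3,5)] by (intro mult_right_mono) auto
          also have "\<dots> \<le> enn2real (\<nu> A) - enn2real (\<nu> B)"
            using hahn_set_pos[OF L v V(3) V(2) E(1) A(1-3) _ A(5,6)] A(4) True by (simp add: W_def)
          finally show ?thesis .
        next
          case False
          then have "A = B" using A by (auto simp: W_def)
          then show ?thesis by simp
        qed
      qed
    next
      assume C: "(A - B) \<inter> (\<Union>k. W t k) = {}"
      \<comment> \<open>The crescent is tested against the Hahn set with its own index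
        \<open>n\<close> and a rational level \<open>q\<close> between \<open>t\<close> and
        \<open>s\<close>, which lies inside the union and is thus missed. Letting \<open>s\<close>
        decrease to \<open>t\<close> gives the bound.\<close>
      have "enn2real (\<nu> A) - enn2real (\<nu> B) \<le> s * (enn2real (\<mu> A) - enn2real (\<mu> B))" if s: "t < s" for s
      proof -
        obtain q where q: "q \<in> \<rat>" "t < q" "q < s" using Rats_dense_in_real[OF s] by blast
        then have "(n, q) \<in> range e" unfolding range I_def using t by auto
        then obtain k where k: "e k = (n, q)" by (metis rangeE)
        then have "\<rho> k = q" by (simp add: \<rho>_def)
        with q C have "(A - B) \<inter> V k = {}" by (auto simp: W_def)
        then have "enn2real (\<nu> A) - enn2real (\<nu> B) \<le> q * (enn2real (\<mu> A) - enn2real (\<mu> B))"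
          using V(3)[of k] AB unfolding k \<open>\<rho> k = q\<close> hahn_set_def fst_conv by blast
        also have "\<dots> \<le> s * (enn2real (\<mu> A) - enn2real (\<mu> B))"
          using q d by (intro mult_right_mono) auto
        finally show ?thesis .
      qed
      then have "enn2real (\<nu> A) - enn2real (\<nu> B)
          \<le> (t + inverse (real (Suc i))) * (enn2real (\<mu> A) - enn2real (\<mu> B))" for i
        by simp
      moreover have "(\<lambda>i. (t + inverse (real (Suc i))) * (enn2real (\<mu> A) - enn2real (\<mu> B)))
          \<longlonglongrightarrow> (t + 0) * (enn2real (\<mu> A) - enn2real (\<mu> B))"
        by (intro tendsto_intros LIMSEQ_inverse_real_of_nat)
      ultimately show "enn2real (\<nu> A) - enn2real (\<nu> B) \<le> t * (enn2real (\<mu> A) - enn2real (\<mu> B))"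
        using LIMSEQ_le_const by (metis (no_types, lifting) add.right_neutral)
    }
  qed
  with g show ?thesis by (rule that)
qed

text \<open>Integration by parts on \<open>{a..b}\<close> leaves two boundary terms. The one at
  \<open>a\<close> approaches \<open>w 0\<close> as \<open>a\<close> tends to 0; the one at
  \<open>b\<close> is handled by Chebyshev's inequality and absolute continuity.\<close>

lemma hahn_superlevel_sets_imp_density:
  assumes L: "lattice_of_sets X L" and v: "valuation L \<mu>" "valuation L \<nu>"
    and g: "g \<in> measurable_maps X L"
    and U: "U \<in> L" "\<mu> U < \<infinity>" "\<nu> U < \<infinity>"
    and H: "\<And>t. 0 \<le> t \<Longrightarrow> hahn_set L \<nu> \<mu> U t {x\<in>X. ennreal t < g x}"
    and ac: "abs_continuous L \<nu> \<mu>"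
  shows "\<nu> U = density_valuation X g \<mu> U"
proof -
  define G where "G t = {x\<in>X. ennreal t < g x}" for t
  have GL: "U \<inter> G t \<in> L" if "t \<ge> 0" for t
    using g that U L by (simp add: G_def measurable_maps_def lattice_of_sets_def)
  have emp: "{} \<in> L" using L by (simp add: lattice_of_sets_def)
  have Ganti: "U \<inter> G t \<subseteq> U \<inter> G s" if "s \<le> t" for s t
    using that by (auto simp: G_def intro: le_less_trans[OF ennreal_leI])
  have le: "\<mu> (U \<inter> G t) \<le> \<mu> U" "\<nu> (U \<inter> G t) \<le> \<nu> U" if "t \<ge> 0" for t
    using GL[OF that] U by (auto intro!: valuation_mono[OF v(1)] valuation_mono[OF v(2)])
  then have fin: "\<mu> (U \<inter> G t) < \<infinity>" "\<nu> (U \<inter> G t) < \<infinity>" if "t \<ge> 0" for t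
    using U(2,3) le_less_trans that by blast+
  define m where "m t = enn2real (\<mu> (U \<inter> G t))" for t
  define w where "w t = enn2real (\<nu> (U \<inter> G t))" for t
  have m0: "0 \<le> m t" "0 \<le> w t" for t by (auto simp: m_def w_def)
  have anti: "m t \<le> m s" if "0 \<le> s" "s \<le> t" for s t
    unfolding m_def using that fin by (intro enn2real_valuation_mono[OF v(1)] GL Ganti) auto
  have Hpos: "t * (enn2real (\<mu> A) - enn2real (\<mu> B)) \<le> enn2real (\<nu> A) - enn2real (\<nu> B)"
    if "0 \<le> t" "A \<in> L" "B \<in> L" "B \<subseteq> A" "A \<subseteq> U" "A - B \<subseteq> G t" for t A B
    using H[OF that(1)] that unfolding hahn_set_def G_def by blast
  have Hneg: "enn2real (\<nu> A) - enn2real (\<nu> B) \<le> t * (enn2real (\<mu> A) - enn2real (\<mu> B))"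
    if "0 \<le> t" "A \<in> L" "B \<in> L" "B \<subseteq> A" "A \<subseteq> U" "(A - B) \<inter> G t = {}" for t A B
    using H[OF that(1)] that unfolding hahn_set_def G_def by blast
  \<comment> \<open>The crescent between \<open>U \<inter> G s\<close> and
    \<open>U \<inter> G t\<close> lies in \<open>G s\<close> and misses \<open>G t\<close>:
    positivity at level \<open>s\<close> gives \<open>lo\<close>, negativity at level
    \<open>t\<close> gives \<open>hi\<close>.\<close>
  have lo: "s * (m s - m t) \<le> w s - w t" if "0 \<le> s" "s \<le> t" for s t
    unfolding m_def w_def using that by (intro Hpos GL Ganti) auto
  have hi: "w s - w t \<le> t * (m s - m t)" if "0 \<le> s" "s \<le> t" for s t
    unfolding m_def w_def using that by (intro Hneg GL Ganti) auto
  \<comment> \<open>Chebyshev's inequality, from positivity with \<open>B = {}\<close>.\<close>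
  have cheb: "t * m t \<le> w t" if "0 \<le> t" for t
    using Hpos[OF that GL[OF that] emp] v by (simp add: m_def w_def valuation_def)
  have w_le: "w t \<le> enn2real (\<nu> U)" if "t \<ge> 0" for t
    unfolding w_def using le[OF that] U by (simp add: enn2real_mono)
  \<comment> \<open>Negativity at level 0: \<open>\<nu>\<close> puts no mass on the part of
    \<open>U\<close> where \<open>g\<close> vanishes.\<close>
  have "enn2real (\<nu> U) - w 0 \<le> 0 * (enn2real (\<mu> U) - m 0)"
    unfolding m_def w_def by (rule Hneg) (use U GL in auto)
  then have w0: "enn2real (\<nu> U) = w 0" using w_le[of 0] by simp
  have \<nu>U: "\<nu> U = ennreal (w 0)" using U(3) by (simp add: w0[symmetric])
  have int: "integral {a..b} m = (w a - a * m a) - (w b - b * m b)" if "0 \<le> a" "a \<le> b" for a b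
    using that by (intro integral_antimono_by_parts(2)) (auto intro: anti lo hi)
  let ?I = "SUP (a, b) \<in> {(a, b). 0 < a \<and> a \<le> b}. ennreal (integral {a..b} m)"
  have "?I = \<nu> U"
  proof (rule antisym)
    show "?I \<le> \<nu> U"
    proof (rule SUP_least, clarify)
      fix a b :: real assume ab: "0 < a" "a \<le> b"
      then have "0 \<le> a * m a" using m0 by simp
      then have "integral {a..b} m \<le> w 0"
        using int[of a b] ab cheb[of b] w_le[of a] w0 by auto
      then show "ennreal (integral {a..b} m) \<le> \<nu> U" unfolding \<nu>U by (rule ennreal_leI)
    qed
    show "\<nu> U \<le> ?I"
    proof (rule ennreal_le_epsilon)
      fix e :: real assume e: "0 < e"
      obtain \<eta> where \<eta>: "\<eta> > 0" "\<And>A. A \<in> L \<Longrightarrow> A \<subseteq> U \<Longrightarrow> \<mu> A < ennreal \<eta> \<Longrightarrow> \<nu> A < ennreal (e / 2)"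
        using ac U(1,3) e unfolding abs_continuous_def by (metis half_gt_zero)
      \<comment> \<open>Here \<open>b * \<eta>\<close> exceeds \<open>w 0\<close>, while
        \<open>b * m b \<le> w b \<le> w 0\<close>; this forces \<open>m b < \<eta>\<close>, and
        absolute continuity then makes \<open>w b\<close> small.\<close>
      define b where "b = w 0 / \<eta> + 1"
      have b: "b > 0" "b * \<eta> = w 0 + \<eta>" using \<eta>(1) m0[of 0]
        by (auto simp: b_def field_simps intro: add_nonneg_pos)
      have "m b < \<eta>"
      proof (rule ccontr)
        assume "\<not> m b < \<eta>"
        then have "b * \<eta> \<le> b * m b" using b(1) by (intro mult_left_mono) auto
        then show False using b(2) cheb[of b] w_le[of b] b(1) w0 \<eta>(1) by linarith
      qed
      then have "\<mu> (U \<inter> G b) < ennreal \<eta>"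
        using fin(1)[of b] b(1) by (simp add: m_def enn2real_less_iff less_top)
      then have "\<nu> (U \<inter> G b) < ennreal (e / 2)" using \<eta>(2) GL[of b] b(1) by simp
      then have wb: "w b < e / 2"
        using fin(2)[of b] b(1) unfolding w_def by (subst enn2real_less_iff) auto
      \<comment> \<open>By \<open>hi\<close> between 0 and \<open>a\<close>, the boundary term
        \<open>w a - a * m a\<close> is at least \<open>w 0 - a * m 0\<close>, so
        \<open>a * m 0\<close> must be at most \<open>e / 2\<close>. The added 1 prevents division
        by zero.\<close>
      define a where "a = min b (e / (2 * (m 0 + 1)))"
      have a: "0 < a" "a \<le> b" using b(1) e m0(1)[of 0] by (auto simp: a_def)
      have "a * m 0 \<le> e / (2 * (m 0 + 1)) * m 0" using m0 by (intro mult_right_mono) (auto simp: a_def)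
      also have "\<dots> \<le> e / 2" using e m0(1)[of 0] by (simp add: field_simps)
      finally have am: "a * m 0 \<le> e / 2" .
      have "0 \<le> b * m b" using b(1) m0 by simp
      then have "w 0 \<le> integral {a..b} m + e"
        using int[of a b] a hi[of 0 a] am wb by (simp add: algebra_simps)
      then have "\<nu> U \<le> ennreal (integral {a..b} m + e)" unfolding \<nu>U by (rule ennreal_leI)
      also have "\<dots> \<le> ennreal (integral {a..b} m) + ennreal e"
        using e by (cases "0 \<le> integral {a..b} m") (auto intro: ennreal_leI simp: ennreal_neg)
      also have "ennreal (integral {a..b} m) \<le> ?I"
        by (rule SUP_upper2[of "(a, b)"]) (use a in auto)
      finally show "\<nu> U \<le> ?I + ennreal e" by (simp add: add_right_mono)
    qed
  qed
  moreover have "density_valuation X g \<mu> U = improper_integral (\<lambda>t. \<mu> (U \<inter> G t))"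
    unfolding G_def by (rule density_valuation_eq_nn_integral(2)[OF L v(1) g U(1)])
  moreover have "improper_integral (\<lambda>t. \<mu> (U \<inter> G t)) = ?I"
  proof -
    have "\<not> (\<exists>t>0. \<mu> (U \<inter> G t) = \<infinity>)" using fin(1) by (metis less_imp_le less_irrefl)
    then show ?thesis unfolding improper_integral_def m_def by (simp only: if_False)
  qed
  ultimately show ?thesis by simp
qed

section \<open>Both implications, and the passage from the sets \<open>E n\<close> to all of
  \<open>L\<close>\<close>

theorem theorem27:
  fixes X :: "'a set" and L :: "'a set set"
    and \<mu> \<nu> :: "'a set \<Rightarrow> ennreal" and E :: "nat \<Rightarrow> 'a set"
  assumes "omega_topological_space X L"
    and "valuation L \<mu>" and "omega_continuous L \<mu>" and "sigma_finite_valuation X L \<mu>"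
    and "valuation L \<nu>" and "omega_continuous L \<nu>" and "sigma_finite_valuation X L \<nu>"
    and "joint_sigma_finiteness_witness X L \<nu> \<mu> E"
  shows "(\<exists>g\<in>measurable_maps X L. \<forall>U\<in>L. \<nu> U = density_valuation X g \<mu> U) \<longleftrightarrow>
    (abs_continuous L \<nu> \<mu> \<and>
     (\<forall>n. \<forall>r::real\<ge>0. hahn_decomposition_property X L (signed_diff (restr \<nu> (E n)) r (restr \<mu> (E n)))))"
proof -
  have L: "lattice_of_sets X L" using assms(1) by (simp add: omega_topological_space_def)
  have E: "\<And>n. E n \<in> L" "incseq E" "(\<Union>n. E n) = X" "\<And>n. \<mu> (E n) < \<infinity>" "\<And>n. \<nu> (E n) < \<infinity>"
    using assms(8) by (auto simp: joint_sigma_finiteness_witness_def)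
  have Int: "A \<inter> B \<in> L" if "A \<in> L" "B \<in> L" for A B using L that by (auto simp: lattice_of_sets_def)
  note iff = hahn_decomposition_property_iff_hahn_set[OF L assms(2,5) E(1,4,5)]
  show ?thesis
    unfolding iff
  proof (intro iffI conjI allI impI)
    assume "\<exists>g\<in>measurable_maps X L. \<forall>U\<in>L. \<nu> U = density_valuation X g \<mu> U"
    then obtain g where g: "g \<in> measurable_maps X L" and dens: "\<And>U. U \<in> L \<Longrightarrow> \<nu> U = density_valuation X g \<mu> U"
      by blast
    show "abs_continuous L \<nu> \<mu>" by (rule density_valuation_abs_continuous[OF L assms(2) g dens])
    fix n and r :: real assume r: "0 \<le> r"
    have "hahn_set L \<nu> \<mu> (E n) r {x\<in>X. ennreal r < g x}"
      by (rule density_valuation_hahn_set[OF L assms(2) g dens E(1,4,5) assms(5) r])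
    then have "hahn_set L \<nu> \<mu> (E n) r ({x\<in>X. ennreal r < g x} \<inter> E n)"
      unfolding hahn_set_def by blast
    moreover have "{x\<in>X. ennreal r < g x} \<inter> E n \<in> L"
      using g r by (intro Int E) (simp add: measurable_maps_def)
    ultimately show "\<exists>U\<in>L. U \<subseteq> E n \<and> hahn_set L \<nu> \<mu> (E n) r U" by blast
  next
    assume *: "abs_continuous L \<nu> \<mu> \<and> (\<forall>n. \<forall>r\<ge>0. \<exists>U\<in>L. U \<subseteq> E n \<and> hahn_set L \<nu> \<mu> (E n) r U)"
    then have Hex: "\<exists>U\<in>L. U \<subseteq> E n \<and> hahn_set L \<nu> \<mu> (E n) r U" if "0 \<le> r" for n r
      using that by blast
    obtain g where g: "g \<in> measurable_maps X L"
      and H: "\<And>n t. 0 \<le> t \<Longrightarrow> hahn_set L \<nu> \<mu> (E n) t {x\<in>X. ennreal t < g x}"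
      by (rule hahn_sets_are_superlevel_sets[where E = E, OF assms(1,2,5,3,6) E(1,4,5) Hex]) auto
    have "\<nu> U = density_valuation X g \<mu> U" if U: "U \<in> L" for U
    proof -
      \<comment> \<open>Finiteness is available only inside \<open>E n\<close>. The formula is
        proved for \<open>U \<inter> E n\<close>, and \<omega>-continuity of both sides extends it
        to \<open>U\<close>.\<close>
      have UE: "U \<inter> E n \<in> L" for n using Int U E by blast
      have inc: "incseq (\<lambda>n. U \<inter> E n)" using E(2) by (fastforce simp: incseq_def)
      have un: "(\<Union>n. U \<inter> E n) = U" using E(3) U L by (auto simp: lattice_of_sets_def)
      have "\<nu> (U \<inter> E n) = density_valuation X g \<mu> (U \<inter> E n)" for n
      proof (rule hahn_superlevel_sets_imp_density[OF L assms(2,5) g UE])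
        show "\<mu> (U \<inter> E n) < \<infinity>" "\<nu> (U \<inter> E n) < \<infinity>"
          using valuation_mono[OF assms(2) UE E(1), of n n] valuation_mono[OF assms(5) UE E(1), of n n] E(4,5)
          by (auto intro: le_less_trans)
        \<comment> \<open>A Hahn set for \<open>E n\<close> serves for any smaller base set, which
          merely admits fewer crescents.\<close>
        show "hahn_set L \<nu> \<mu> (U \<inter> E n) t {x\<in>X. ennreal t < g x}" if "0 \<le> t" for t
          using H[OF that, of n] unfolding hahn_set_def by blast
      qed (use * in blast)
      moreover have "\<nu> U = (SUP n. \<nu> (U \<inter> E n))"
        using assms(6)[unfolded omega_continuous_def, rule_format, OF UE inc] un by simp
      moreover have "density_valuation X g \<mu> U = (SUP n. density_valuation X g \<mu> (U \<inter> E n))"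
        using density_valuation_omega_continuous[OF assms(1-3) g, unfolded omega_continuous_def, rule_format, OF UE inc]
        un by simp
      ultimately show ?thesis by simp
    qed
    with g show "\<exists>g\<in>measurable_maps X L. \<forall>U\<in>L. \<nu> U = density_valuation X g \<mu> U" by blast
  qed
qed

end
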